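(* Assume Hypothesis (H): there is a constant $d\ge1$ such that every language in $\mathsf{P}$ is decided by circuits of size $O(n^d)$. Then there is a polynomial-time computable proof complexity generator $g$ (a function stretching every input of length $n$ to some length $m(n)>n$) whose range intersects every feasibly infinite $\mathsf{NP}$ set.
   Context: A set $A\in\mathsf{NP}$ (identifying binary strings with natural numbers) is feasibly infinite if there is a polynomial-time function $f$ such that for all $x$: $f(x)>x$ and $f(x)\in A$. *)

theory Defs
  imports Complex_Main "HOL-Computational_Algebra.Polynomial" "HOL-Library.Landau_Symbols"
begin

type_synonym str = "bool list"

text \<open>Deterministic multi-tape Turing machines. States are \<open>{..<tm_states M}\<close> together with the halting
  state \<open>tm_states M\<close>; the start state is 0. Symbols are \<open>{..<tm_symbols M}\<close>, with 0 the blank, 1 and 2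
  the bits 0 and 1. Tapes are infinite in both directions; a tape consists of a head position and the
  cell contents.\<close>

datatype move = MLeft | MStay | MRight

record tm =
  tm_tapes :: nat
  tm_states :: nat
  tm_symbols :: nat
  tm_delta :: "nat \<Rightarrow> nat list \<Rightarrow> nat \<times> (nat \<times> move) list"

definition wf_tm :: "tm \<Rightarrow> bool" where
  "wf_tm M \<longleftrightarrow> tm_tapes M \<ge> 1 \<and> tm_symbols M \<ge> 3 \<and>
     (\<forall>q < tm_states M. \<forall>as. length as = tm_tapes M \<and> set as \<subseteq> {..<tm_symbols M} \<longrightarrow>
        (case tm_delta M q as of (q', acts) \<Rightarrow>
           q' \<le> tm_states M \<and> length acts = tm_tapes M \<and> fst ` set acts \<subseteq> {..<tm_symbols M}))"

type_synonym tape = "int \<times> (int \<Rightarrow> nat)"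
type_synonym config = "nat \<times> tape list"

fun tape_read :: "tape \<Rightarrow> nat" where
  "tape_read (h, c) = c h"

fun head_shift :: "move \<Rightarrow> int" where
  "head_shift MLeft = -1"
| "head_shift MStay = 0"
| "head_shift MRight = 1"

fun tape_act :: "nat \<times> move \<Rightarrow> tape \<Rightarrow> tape" where
  "tape_act (s, d) (h, c) = (h + head_shift d, c(h := s))"

definition tm_step :: "tm \<Rightarrow> config \<Rightarrow> config" where
  "tm_step M cf = (case cf of (q, ts) \<Rightarrow>
     if q < tm_states M
     then (case tm_delta M q (map tape_read ts) of (q', acts) \<Rightarrow> (q', map2 tape_act acts ts))
     else (q, ts))"

definition str_tape :: "str \<Rightarrow> tape" where
  "str_tape x = (0, \<lambda>i. if 0 \<le> i \<and> i < int (length x) then (if x ! nat i then 2 else 1) else 0)"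

definition tm_init :: "tm \<Rightarrow> str \<Rightarrow> config" where
  "tm_init M x = (0, str_tape x # replicate (tm_tapes M - 1) (str_tape []))"

text \<open>The input is on the first tape. The output is on the last tape, with the head back on its first
  cell; the other tapes may hold anything on halting.\<close>

definition tm_outputs_within :: "tm \<Rightarrow> str \<Rightarrow> str \<Rightarrow> nat \<Rightarrow> bool" where
  "tm_outputs_within M x y t \<longleftrightarrow>
     (case (tm_step M ^^ t) (tm_init M x) of (q, ts) \<Rightarrow> q = tm_states M \<and> last ts = str_tape y)"

definition polytime_computable :: "(str \<Rightarrow> str) \<Rightarrow> bool" where
  "polytime_computable f \<longleftrightarrow>
     (\<exists>M (p :: nat poly). wf_tm M \<and> (\<forall>x. tm_outputs_within M x (f x) (poly p (length x))))"

definition class_P :: "str set set" where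
  "class_P = {L. polytime_computable (\<lambda>x. [x \<in> L])}"

text \<open>Pairing of strings: the bits of the first component are doubled, and 01 acts as separator.\<close>

definition str_pair :: "str \<Rightarrow> str \<Rightarrow> str" where
  "str_pair x w = concat (map (\<lambda>b. [b, b]) x) @ [False, True] @ w"

definition class_NP :: "str set set" where
  "class_NP = {A. \<exists>R \<in> class_P. \<exists>p :: nat poly.
     \<forall>x. x \<in> A \<longleftrightarrow> (\<exists>w. length w \<le> poly p (length x) \<and> str_pair x w \<in> R)}"

text \<open>Boolean circuits with \<open>n\<close> inputs as straight-line programs over the De Morgan basis: wires
  \<open>0, ..., n - 1\<close> are the inputs, wire \<open>n + j\<close> is the output of the \<open>j\<close>-th gate, and the last gate is the
  output gate. The size is the number of gates.\<close>

datatype gate = GConst bool | GNot nat | GAnd nat nat | GOr nat nat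

type_synonym circuit = "gate list"

fun gate_wires :: "gate \<Rightarrow> nat set" where
  "gate_wires (GConst b) = {}"
| "gate_wires (GNot i) = {i}"
| "gate_wires (GAnd i j) = {i, j}"
| "gate_wires (GOr i j) = {i, j}"

definition wf_circuit :: "nat \<Rightarrow> circuit \<Rightarrow> bool" where
  "wf_circuit n C \<longleftrightarrow> C \<noteq> [] \<and> (\<forall>j < length C. gate_wires (C ! j) \<subseteq> {..<n + j})"

fun gate_val :: "bool list \<Rightarrow> gate \<Rightarrow> bool" where
  "gate_val vs (GConst b) = b"
| "gate_val vs (GNot i) = (\<not> vs ! i)"
| "gate_val vs (GAnd i j) = (vs ! i \<and> vs ! j)"
| "gate_val vs (GOr i j) = (vs ! i \<or> vs ! j)"

definition circuit_eval :: "circuit \<Rightarrow> str \<Rightarrow> bool" where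
  "circuit_eval C x = last (foldl (\<lambda>vs g. vs @ [gate_val vs g]) x C)"

definition decided_by_circuits_of_size :: "str set \<Rightarrow> (nat \<Rightarrow> nat) \<Rightarrow> bool" where
  "decided_by_circuits_of_size L s \<longleftrightarrow>
     (\<forall>n. \<exists>C. wf_circuit n C \<and> length C \<le> s n \<and>
        (\<forall>x. length x = n \<longrightarrow> (circuit_eval C x \<longleftrightarrow> x \<in> L)))"

definition hypothesis_H :: bool where
  "hypothesis_H \<longleftrightarrow> (\<exists>d :: real. d \<ge> 1 \<and>
     (\<forall>L \<in> class_P. \<exists>s. (\<lambda>n. real (s n)) \<in> O(\<lambda>n. real n powr d) \<and>
        decided_by_circuits_of_size L s))"

text \<open>The identification of strings with natural numbers: the position of a string in the
  length-lexicographic order, i.e. the number with binary expansion 1w, minus 1.\<close>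

definition nat_of_str :: "str \<Rightarrow> nat" where
  "nat_of_str = foldl (\<lambda>n b. 2 * n + (if b then 2 else 1)) 0"

lemma bij_nat_of_str: "bij nat_of_str"
proof (rule bijI)
  have snoc: "nat_of_str (w @ [b]) = 2 * nat_of_str w + (if b then 2 else 1)" for w b
    by (simp add: nat_of_str_def)
  have nil: "nat_of_str [] = 0" by (simp add: nat_of_str_def)
  have "nat_of_str v = nat_of_str w \<Longrightarrow> v = w" for v w
  proof (induction v arbitrary: w rule: rev_induct)
    case Nil
    then show ?case by (cases w rule: rev_cases) (auto simp: snoc nil split: if_splits)
  next
    case (snoc b v)
    note eq = snoc.prems and IH = snoc.IH
    show ?case
    proof (cases w rule: rev_cases)
      case Nil
      then show ?thesis using eq by (simp add: nat_of_str_def split: if_splits)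
    next
      case (snoc u c)
      have *: "2 * nat_of_str v + (if b then 2 else 1) = 2 * nat_of_str u + (if c then 2 else 1)"
        using eq by (simp add: snoc nat_of_str_def)
      then have "b = c" by (auto split: if_splits) presburger+
      with * IH show ?thesis by (auto simp: snoc)
    qed
  qed
  then show "inj nat_of_str" by (auto intro: injI)
  have "\<exists>w. nat_of_str w = n" for n
  proof (induction n rule: less_induct)
    case (less n)
    show ?case
    proof (cases "n = 0")
      case True
      then show ?thesis using nil by blast
    next
      case False
      then have "(n - 1) div 2 < n" by linarith
      then obtain w where "nat_of_str w = (n - 1) div 2" using less by blast
      then have "nat_of_str (w @ [even n]) = 2 * ((n - 1) div 2) + (if even n then 2 else 1)"
        by (simp only: snoc)
      also have "\<dots> = n" using False by (simp split: if_split) presburger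
      finally have "nat_of_str (w @ [even n]) = n" .
      then show ?thesis by blast
    qed
  qed
  then show "surj nat_of_str" by (metis surjI)
qed

definition feasibly_infinite :: "str set \<Rightarrow> bool" where
  "feasibly_infinite A \<longleftrightarrow>
     (\<exists>f. polytime_computable f \<and> (\<forall>x. nat_of_str (f x) > nat_of_str x \<and> f x \<in> A))"

definition proof_complexity_generator :: "(str \<Rightarrow> str) \<Rightarrow> bool" where
  "proof_complexity_generator g \<longleftrightarrow>
     (\<exists>m :: nat \<Rightarrow> nat. (\<forall>n. m n > n) \<and> (\<forall>x. length (g x) = m (length x)))"

end

theory Submission imports Defs begin

text \<open>Let \<open>f\<close> witness that \<open>A\<close> is feasibly infinite. For a constant \<open>K\<close>, the language of all \<open>z\<close> such that
  the bit of \<open>f (1 ^ N ^ K)\<close> with number \<open>z\<close> (read in binary) is 1, where \<open>N\<close> is the length of \<open>z\<close>, is in P.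
  The long binary index \<open>z\<close> acts as padding: by (H), the bits of a string of length at least \<open>N ^ K\<close> are
  computed by a circuit of size \<open>O(N ^ d)\<close>, so for \<open>K > 2 * d\<close> and large \<open>N\<close> the string is longer than a
  description of the circuit. The generator reads its input as the description of a circuit and outputs
  the beginning of the truth table, one bit longer than the input; since descriptions can be padded, every
  string with a short circuit is in its range, and hence so is the element \<open>f (1 ^ N ^ K)\<close> of \<open>A\<close>.

  Polynomial-time computability is obtained by compiling structured programs into Turing
  machines.\<close>


section \<open>Structured programs for Turing machines\<close>

text \<open>Hypothesis (H) fixes the exponent \<open>d\<close> before the language, and this order
  of quantifiers drives the argument: \<open>K\<close> depends on \<open>d\<close> alone, while
  \<open>f\<close> (its running time, and the constant of the O-bound for its lookup language) only
  influences how large \<open>N\<close> has to be. In particular \<open>N\<close> must be so large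
  that every position in \<open>f (1 ^ N ^ K)\<close> has an index of \<open>N\<close> bits. One
  suitable \<open>N\<close> is enough. The generator, in contrast, may depend neither on
  \<open>f\<close> nor on \<open>d\<close>, so it is a universal evaluator that takes the arity and
  the circuit from its input. Its input format is shaped by the need to exhibit an actual machine:
  NOR gates given by bit masks are evaluated by moving two heads in step over wires and mask bits,
  without addresses or gate types. The price is a description quadratic in the number of gates,
  which is where the 2 in \<open>K > 2 * d\<close> comes from. For the lookup language,
  \<open>f\<close> is known only through some arbitrary machine, so programs must also be able to
  run a given machine as a subroutine.\<close>

type_synonym action = "nat \<Rightarrow> nat \<times> move"
type_synonym store = "nat \<Rightarrow> tape"

datatype prog =
    Act "(nat \<Rightarrow> nat) \<Rightarrow> action"
  | Seq prog prog (infixr ";;" 60)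
  | Cond "(nat \<Rightarrow> nat) \<Rightarrow> bool" prog prog
  | While "(nat \<Rightarrow> nat) \<Rightarrow> bool" prog

definition rd :: "store \<Rightarrow> nat \<Rightarrow> nat" where
  "rd \<sigma> = (\<lambda>i. tape_read (\<sigma> i))"

definition acts :: "action \<Rightarrow> store \<Rightarrow> store" where
  "acts A \<sigma> = (\<lambda>i. tape_act (A i) (\<sigma> i))"

definition stay :: "(nat \<Rightarrow> nat) \<Rightarrow> action" where
  "stay r = (\<lambda>i. (r i, MStay))"

lemma rd_apply [simp]: "rd \<sigma> i = tape_read (\<sigma> i)"
  by (simp add: rd_def)

lemma acts_upd [simp]: "acts (A(j := x)) \<sigma> = (acts A \<sigma>)(j := tape_act x (\<sigma> j))"
  by (auto simp: acts_def)

lemma acts_stay [simp]: "acts (stay (rd \<sigma>)) \<sigma> = \<sigma>"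
proof
  fix i show "acts (stay (rd \<sigma>)) \<sigma> i = \<sigma> i"
    by (cases "\<sigma> i") (simp add: acts_def stay_def)
qed

text \<open>The number in \<open>runs p \<sigma> t \<tau>\<close> is only an upper bound for the running time.\<close>

inductive runs :: "prog \<Rightarrow> store \<Rightarrow> nat \<Rightarrow> store \<Rightarrow> bool" where
  act: "runs (Act a) \<sigma> 1 (acts (a (rd \<sigma>)) \<sigma>)"
| seq: "runs p \<sigma> s \<tau> \<Longrightarrow> runs q \<tau> t \<rho> \<Longrightarrow> runs (p ;; q) \<sigma> (s + t) \<rho>"
| if_true: "c (rd \<sigma>) \<Longrightarrow> runs p \<sigma> t \<tau> \<Longrightarrow> runs (Cond c p q) \<sigma> (Suc t) \<tau>"
| if_false: "\<not> c (rd \<sigma>) \<Longrightarrow> runs q \<sigma> t \<tau> \<Longrightarrow> runs (Cond c p q) \<sigma> (Suc t) \<tau>"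
| while_false: "\<not> c (rd \<sigma>) \<Longrightarrow> runs (While c p) \<sigma> 1 \<sigma>"
| while_true: "c (rd \<sigma>) \<Longrightarrow> runs p \<sigma> s \<tau> \<Longrightarrow> runs (While c p) \<tau> t \<rho> \<Longrightarrow>
    runs (While c p) \<sigma> (Suc (s + t)) \<rho>"
| weaken: "runs p \<sigma> s \<tau> \<Longrightarrow> s \<le> t \<Longrightarrow> runs p \<sigma> t \<tau>"

lemma runs_cong: "runs p \<sigma> s \<tau> \<Longrightarrow> s \<le> t \<Longrightarrow> \<tau> = \<rho> \<Longrightarrow> runs p \<sigma> t \<rho>"
  using runs.weaken by blast

lemma runs_Act: "acts (a (rd \<sigma>)) \<sigma> = \<tau> \<Longrightarrow> 1 \<le> t \<Longrightarrow> runs (Act a) \<sigma> t \<tau>"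
  using runs.act runs_cong by blast

lemma runs_Seq:
  "runs p \<sigma> s \<tau> \<Longrightarrow> runs q \<tau> t \<rho> \<Longrightarrow> s + t \<le> u \<Longrightarrow> runs (p ;; q) \<sigma> u \<rho>"
  by (meson runs.seq runs.weaken)

lemma runs_While_true:
  "c (rd \<sigma>) \<Longrightarrow> runs p \<sigma> s \<tau> \<Longrightarrow> runs (While c p) \<tau> t \<rho> \<Longrightarrow> Suc (s + t) \<le> u \<Longrightarrow>
    runs (While c p) \<sigma> u \<rho>"
  by (meson runs.while_true runs.weaken)

lemma runs_While_false: "\<not> c (rd \<sigma>) \<Longrightarrow> 1 \<le> u \<Longrightarrow> runs (While c p) \<sigma> u \<sigma>"
  by (meson runs.while_false runs.weaken)

lemma runs_If_true: "c (rd \<sigma>) \<Longrightarrow> runs p \<sigma> t \<tau> \<Longrightarrow> Suc t \<le> u \<Longrightarrow> runs (Cond c p q) \<sigma> u \<tau>"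
  by (meson runs.if_true runs.weaken)

lemma runs_If_false: "\<not> c (rd \<sigma>) \<Longrightarrow> runs q \<sigma> t \<tau> \<Longrightarrow> Suc t \<le> u \<Longrightarrow> runs (Cond c p q) \<sigma> u \<tau>"
  by (meson runs.if_false runs.weaken)

section \<open>Translation of programs into transition tables\<close>

fun prog_size :: "prog \<Rightarrow> nat" where
  "prog_size (Act a) = 1"
| "prog_size (p ;; q) = prog_size p + prog_size q"
| "prog_size (Cond c p q) = Suc (prog_size p + prog_size q)"
| "prog_size (While c p) = Suc (prog_size p)"

text \<open>\<open>prog_delta p b n\<close> is the transition function of \<open>p\<close>, whose code occupies the states
  \<open>{b..<b + prog_size p}\<close>, is entered at \<open>b\<close> and left towards \<open>n\<close>.\<close>

fun prog_delta :: "prog \<Rightarrow> nat \<Rightarrow> nat \<Rightarrow> nat \<Rightarrow> (nat \<Rightarrow> nat) \<Rightarrow> nat \<times> action" where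
  "prog_delta (Act a) b n s r = (n, a r)"
| "prog_delta (p ;; q) b n s r =
    (if s < b + prog_size p then prog_delta p b (b + prog_size p) s r
     else prog_delta q (b + prog_size p) n s r)"
| "prog_delta (Cond c p q) b n s r =
    (if s = b then (if c r then Suc b else Suc b + prog_size p, stay r)
     else if s < Suc b + prog_size p then prog_delta p (Suc b) n s r
     else prog_delta q (Suc b + prog_size p) n s r)"
| "prog_delta (While c p) b n s r =
    (if s = b then (if c r then Suc b else n, stay r) else prog_delta p (Suc b) b s r)"

definition mstep :: "(nat \<Rightarrow> (nat \<Rightarrow> nat) \<Rightarrow> nat \<times> action) \<Rightarrow> nat \<times> store \<Rightarrow> nat \<times> store" where
  "mstep \<Delta> = (\<lambda>(q, \<sigma>). (fst (\<Delta> q (rd \<sigma>)), acts (snd (\<Delta> q (rd \<sigma>))) \<sigma>))"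

text \<open>The bound \<open>N\<close> on the states visited before the exit keeps the run away from halting states.\<close>

inductive reaches :: "(nat \<Rightarrow> (nat \<Rightarrow> nat) \<Rightarrow> nat \<times> action) \<Rightarrow> nat \<Rightarrow> nat \<times> store \<Rightarrow> nat \<Rightarrow> nat \<times> store \<Rightarrow> bool"
  for \<Delta> N where
  stop: "reaches \<Delta> N c t c"
| step: "q < N \<Longrightarrow> reaches \<Delta> N (mstep \<Delta> (q, \<sigma>)) t c \<Longrightarrow> reaches \<Delta> N (q, \<sigma>) (Suc t) c"

lemma reaches_mono: "reaches \<Delta> N c s d \<Longrightarrow> s \<le> t \<Longrightarrow> reaches \<Delta> N c t d"
proof (induction arbitrary: t rule: reaches.induct)
  case (step q \<sigma> s c)
  then obtain t' where "t = Suc t'" "s \<le> t'" by (cases t) auto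
  then show ?case using step reaches.step by blast
qed (rule reaches.stop)

lemma reaches_trans: "reaches \<Delta> N c s d \<Longrightarrow> reaches \<Delta> N d t e \<Longrightarrow> reaches \<Delta> N c (s + t) e"
proof (induction rule: reaches.induct)
  case (stop c s)
  then show ?case by (rule reaches_mono) simp
next
  case (step q \<sigma> s c)
  then show ?case by (simp add: reaches.step)
qed

text \<open>Agreement of \<open>\<Delta>\<close> with the code of \<open>p\<close> is demanded only
  on the states of \<open>p\<close>, so the induction can descend to subprograms inside the table of
  the whole. Entry and exit vary as well: a loop body is entered at \<open>Suc b\<close> and left
  towards \<open>b\<close>.\<close>

lemma runs_reaches:
  assumes "runs p \<sigma> t \<tau>"
    and "\<And>s r. b \<le> s \<Longrightarrow> s < b + prog_size p \<Longrightarrow> \<Delta> s r = prog_delta p b n s r"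
    and "b + prog_size p \<le> N"
  shows "reaches \<Delta> N (b, \<sigma>) t (n, \<tau>)"
  using assms
proof (induction arbitrary: b n rule: runs.induct)
  case (act a \<sigma>)
  then have "mstep \<Delta> (b, \<sigma>) = (n, acts (a (rd \<sigma>)) \<sigma>)"
    by (simp add: mstep_def)
  then show ?case
    using reaches.step[of b N \<Delta> \<sigma> 0] reaches.stop act by simp
next
  case (seq p \<sigma> s \<tau> q t \<rho>)
  have "reaches \<Delta> N (b, \<sigma>) s (b + prog_size p, \<tau>)"
    by (rule seq.IH(1)) (use seq.prems in auto)
  moreover have "reaches \<Delta> N (b + prog_size p, \<tau>) t (n, \<rho>)"
    by (rule seq.IH(2)) (use seq.prems in auto)
  ultimately show ?case by (rule reaches_trans)
next
  case (if_true c \<sigma> p t \<tau> q)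
  have "reaches \<Delta> N (Suc b, \<sigma>) t (n, \<tau>)"
    by (rule if_true.IH) (use if_true.prems in auto)
  moreover have "mstep \<Delta> (b, \<sigma>) = (Suc b, \<sigma>)"
    using if_true by (simp add: mstep_def)
  ultimately show ?case using if_true.prems by (auto intro: reaches.step)
next
  case (if_false c \<sigma> q t \<tau> p)
  have "reaches \<Delta> N (Suc b + prog_size p, \<sigma>) t (n, \<tau>)"
    by (rule if_false.IH) (use if_false.prems in auto)
  moreover have "mstep \<Delta> (b, \<sigma>) = (Suc b + prog_size p, \<sigma>)"
    using if_false by (simp add: mstep_def)
  ultimately show ?case using if_false.prems by (auto intro: reaches.step)
next
  case (while_false c \<sigma> p)
  then have "mstep \<Delta> (b, \<sigma>) = (n, \<sigma>)"
    by (simp add: mstep_def)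
  then show ?case
    using reaches.step[of b N \<Delta> \<sigma> 0] reaches.stop while_false by simp
next
  case (while_true c \<sigma> p s \<tau> t \<rho>)
  have "reaches \<Delta> N (Suc b, \<sigma>) s (b, \<tau>)"
    by (rule while_true.IH(1)) (use while_true.prems in auto)
  moreover have "reaches \<Delta> N (b, \<tau>) t (n, \<rho>)"
    by (rule while_true.IH(2)) (use while_true.prems in auto)
  ultimately have "reaches \<Delta> N (Suc b, \<sigma>) (s + t) (n, \<rho>)" by (rule reaches_trans)
  moreover have "mstep \<Delta> (b, \<sigma>) = (Suc b, \<sigma>)"
    using while_true by (simp add: mstep_def)
  ultimately show ?case using while_true.prems by (auto intro: reaches.step)
next
  case (weaken p \<sigma> s \<tau> t)
  then show ?case by (blast intro: reaches_mono)
qed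

text \<open>A store has infinitely many tapes, a machine only \<open>k\<close>. The last clause
  keeps the surplus tapes blank and unmoved, so that dropping them loses nothing.\<close>

definition wf_act :: "nat \<Rightarrow> nat \<Rightarrow> ((nat \<Rightarrow> nat) \<Rightarrow> action) \<Rightarrow> bool" where
  "wf_act k S a \<longleftrightarrow> (\<forall>r. (\<forall>i. r i < S) \<longrightarrow>
     (\<forall>i. fst (a r i) < S \<and> (k \<le> i \<longrightarrow> r i = 0 \<longrightarrow> a r i = (0, MStay))))"

fun wf_prog :: "nat \<Rightarrow> nat \<Rightarrow> prog \<Rightarrow> bool" where
  "wf_prog k S (Act a) = wf_act k S a"
| "wf_prog k S (p ;; q) = (wf_prog k S p \<and> wf_prog k S q)"
| "wf_prog k S (Cond c p q) = (wf_prog k S p \<and> wf_prog k S q)"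
| "wf_prog k S (While c p) = wf_prog k S p"

lemma wf_act_stay: "wf_act k S stay"
  by (simp add: wf_act_def stay_def)

lemma trans_wf:
  assumes "wf_prog k S p"
  shows "wf_act k S (\<lambda>r. snd (prog_delta p b n s r))"
  using assms
proof (induction p arbitrary: b n)
  case (Cond c p q)
  then show ?case using wf_act_stay[of k S] by (auto simp: wf_act_def)
next
  case (While c p)
  then show ?case using wf_act_stay[of k S] by (auto simp: wf_act_def)
qed (auto simp: wf_act_def)

lemma trans_state_le:
  "fst (prog_delta p b n s r) \<le> max n (b + prog_size p)"
proof (induction p arbitrary: b n)
  case (Seq p q)
  show ?case using Seq(1)[of b "b + prog_size p"] Seq(2)[of "b + prog_size p" n]
    by (auto simp: max_def split: if_splits)
next
  case (Cond c p q)
  show ?case using Cond(1)[of "Suc b" n] Cond(2)[of "Suc b + prog_size p" n]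
    by (auto simp: max_def split: if_splits)
next
  case (While c p)
  show ?case using While[of "Suc b" b] by (auto simp: max_def split: if_splits)
qed auto

definition nth0 :: "nat list \<Rightarrow> nat \<Rightarrow> nat" where
  "nth0 as i = (if i < length as then as ! i else 0)"

definition prog_tm :: "nat \<Rightarrow> nat \<Rightarrow> prog \<Rightarrow> tm" where
  "prog_tm k S p = \<lparr>tm_tapes = k, tm_states = prog_size p, tm_symbols = S,
     tm_delta = (\<lambda>q as. case prog_delta p 0 (prog_size p) q (nth0 as) of
       (q', A) \<Rightarrow> (q', map A [0..<k]))\<rparr>"

lemma wf_prog_tm:
  assumes "wf_prog k S p" "1 \<le> k" "3 \<le> S"
  shows "wf_tm (prog_tm k S p)"
  unfolding wf_tm_def
proof (intro conjI allI impI)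
  fix q as
  assume "length as = tm_tapes (prog_tm k S p) \<and> set as \<subseteq> {..<tm_symbols (prog_tm k S p)}"
  then have "length as = k" "set as \<subseteq> {..<S}" by (auto simp: prog_tm_def)
  then have "nth0 as i < S" for i
    using assms by (auto simp: nth0_def dest: nth_mem)
  then have "fst (snd (prog_delta p 0 (prog_size p) q (nth0 as)) i) < S" for i
    using trans_wf[OF assms(1), of 0 "prog_size p" q] by (auto simp: wf_act_def)
  then show "case tm_delta (prog_tm k S p) q as of (q', ms) \<Rightarrow>
      q' \<le> tm_states (prog_tm k S p) \<and> length ms = tm_tapes (prog_tm k S p) \<and>
      fst ` set ms \<subseteq> {..<tm_symbols (prog_tm k S p)}"
    using trans_state_le[of p 0 "prog_size p" q "nth0 as"]
    by (auto simp: prog_tm_def split: prod.splits)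
qed (use assms in \<open>auto simp: prog_tm_def\<close>)

definition good_store :: "nat \<Rightarrow> nat \<Rightarrow> store \<Rightarrow> bool" where
  "good_store k S \<sigma> \<longleftrightarrow> (\<forall>i j. snd (\<sigma> i) j < S) \<and> (\<forall>i\<ge>k. \<sigma> i = str_tape [])"

lemma tape_read_conv: "tape_read t = snd t (fst t)"
  by (cases t) simp

lemma tape_act_conv: "tape_act a t = (fst t + head_shift (snd a), (snd t)(fst t := fst a))"
  by (cases t; cases a) simp

text \<open>The invariant is \<open>good_store\<close>: symbols stay below \<open>S\<close>, which
  makes \<open>wf_act\<close> applicable at every step, and the tapes from \<open>k\<close> on stay
  empty, so the machine's list of \<open>k\<close> symbols, extended by zeros, is what the program
  reads.\<close>

lemma reaches_tm:
  assumes "reaches (prog_delta p 0 (prog_size p)) (prog_size p) c t d"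
    and "wf_prog k S p" "good_store k S (snd c)"
  shows "\<exists>t'\<le>t. (tm_step (prog_tm k S p) ^^ t') (fst c, map (snd c) [0..<k]) = (fst d, map (snd d) [0..<k])"
  using assms(1,3)
proof (induction rule: reaches.induct)
  case (stop c t)
  then show ?case by (intro exI[of _ 0]) auto
next
  case (step q \<sigma> t d)
  let ?M = "prog_tm k S p"
  obtain q' A where qA: "prog_delta p 0 (prog_size p) q (rd \<sigma>) = (q', A)" by fastforce
  have good: "good_store k S \<sigma>" using step by simp
  have rdS: "rd \<sigma> i < S" for i
    using good by (auto simp: good_store_def tape_read_conv)
  have rd0: "rd \<sigma> i = 0" if "i \<ge> k" for i
    using good that by (simp add: good_store_def str_tape_def)
  have nth0: "nth0 (map tape_read (map \<sigma> [0..<k])) = rd \<sigma>"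
    using rd0 by (auto simp: nth0_def)
  have A: "fst (A i) < S" "i \<ge> k \<Longrightarrow> A i = (0, MStay)" for i
    using trans_wf[OF assms(2), of 0 "prog_size p" q] rdS rd0 qA
    unfolding wf_act_def by (metis snd_conv)+
  have good': "good_store k S (acts A \<sigma>)"
    using good A by (auto simp: good_store_def acts_def tape_act_conv str_tape_def fun_eq_iff)
  have map2: "map2 tape_act (map A [0..<k]) (map \<sigma> [0..<k]) = map (acts A \<sigma>) [0..<k]"
    by (rule nth_equalityI) (auto simp: acts_def)
  have "tm_step ?M (q, map \<sigma> [0..<k]) = (q', map (acts A \<sigma>) [0..<k])"
    using step.hyps(1) nth0 qA map2 by (simp add: tm_step_def prog_tm_def)
  moreover have "mstep (prog_delta p 0 (prog_size p)) (q, \<sigma>) = (q', acts A \<sigma>)"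
    by (simp add: mstep_def qA)
  moreover obtain t' where "t' \<le> t" and
    "(tm_step ?M ^^ t') (fst (mstep (prog_delta p 0 (prog_size p)) (q, \<sigma>)),
       map (snd (mstep (prog_delta p 0 (prog_size p)) (q, \<sigma>))) [0..<k]) = (fst d, map (snd d) [0..<k])"
    using step.IH good' by (auto simp: mstep_def qA)
  ultimately show ?case
    by (intro exI[of _ "Suc t'"]) (simp add: funpow_swap1)
qed

definition init_store :: "str \<Rightarrow> store" where
  "init_store x = (\<lambda>_. str_tape [])(0 := str_tape x)"

lemma tm_step_halted: "(tm_step M ^^ n) (tm_states M, ts) = (tm_states M, ts)"
  by (induction n) (auto simp: tm_step_def)

text \<open>An upper bound on the time suffices although \<open>tm_outputs_within\<close> inspects
  one exact moment, because a halted configuration no longer changes.\<close>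

lemma polytime_computable_if_runs:
  fixes p :: prog and q :: "nat poly"
  assumes wf: "wf_prog k S p" "1 \<le> k" "3 \<le> S"
    and runs: "\<And>x. runs p (init_store x) (poly q (length x)) (\<tau> x)"
    and out: "\<And>x. \<tau> x (k - 1) = str_tape (F x)"
  shows "polytime_computable F"
  unfolding polytime_computable_def
proof (intro exI conjI allI)
  show "wf_tm (prog_tm k S p)" using wf by (rule wf_prog_tm)
  fix x
  let ?M = "prog_tm k S p"
  have "reaches (prog_delta p 0 (prog_size p)) (prog_size p) (0, init_store x) (poly q (length x)) (prog_size p, \<tau> x)"
    by (rule runs_reaches[OF runs]) auto
  moreover have "good_store k S (init_store x)"
    using wf by (auto simp: good_store_def init_store_def str_tape_def)
  ultimately obtain t where t: "t \<le> poly q (length x)" and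
    "(tm_step ?M ^^ t) (0, map (init_store x) [0..<k]) = (prog_size p, map (\<tau> x) [0..<k])"
    using reaches_tm[OF _ wf(1)] by fastforce
  moreover have "map (init_store x) [0..<k] = str_tape x # replicate (k - 1) (str_tape [])"
    using wf by (intro nth_equalityI) (auto simp: init_store_def nth_Cons split: nat.split)
  ultimately have run: "(tm_step ?M ^^ t) (tm_init ?M x) = (tm_states ?M, map (\<tau> x) [0..<k])"
    by (simp add: tm_init_def prog_tm_def)
  obtain s where "poly q (length x) = s + t" using t by (metis le_iff_add add.commute)
  then have "(tm_step ?M ^^ poly q (length x)) (tm_init ?M x) = (tm_states ?M, map (\<tau> x) [0..<k])"
    by (simp add: funpow_add run tm_step_halted)
  moreover have "last (map (\<tau> x) [0..<k]) = str_tape (F x)"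
    using wf out by (simp add: last_map)
  ultimately show "tm_outputs_within ?M x (F x) (poly q (length x))"
    by (simp add: tm_outputs_within_def)
qed


section \<open>Tapes as zippers\<close>

text \<open>A zipper: \<open>l\<close> is what lies left of the head, nearest cell first, and
  \<open>r\<close> starts under the head. The written part is anchored at cell 0, since
  \<open>str_tape\<close> fixes the absolute position of head and contents.\<close>

definition T :: "nat list \<Rightarrow> nat list \<Rightarrow> tape" where
  "T l r = (int (length l),
     \<lambda>i. if 0 \<le> i \<and> i < int (length l + length r) then (rev l @ r) ! nat i else 0)"

definition T_before :: "nat list \<Rightarrow> tape" where
  "T_before r = (-1, snd (T [] r))"

definition enc :: "bool \<Rightarrow> nat" where
  "enc b = (if b then 2 else 1)"

definition encs :: "bool list \<Rightarrow> nat list" where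
  "encs = map enc"

text \<open>Unlike in \<open>enc\<close>, False is the blank, so that a fresh tape is already a
  lowered flag.\<close>

definition bitc :: "bool \<Rightarrow> nat" where
  "bitc b = (if b then 1 else 0)"

lemma enc_simps [simp]:
  "enc b \<noteq> 0" "0 < enc b" "enc b = 2 \<longleftrightarrow> b" "enc b = Suc 0 \<longleftrightarrow> \<not> b" "enc b = 1 \<longleftrightarrow> \<not> b"
  by (auto simp: enc_def)

lemma encs_simps [simp]:
  "encs [] = []" "encs (b # bs) = enc b # encs bs" "encs (bs @ cs) = encs bs @ encs cs"
  "rev (encs bs) = encs (rev bs)" "length (encs bs) = length bs" "0 \<notin> set (encs bs)"
  "encs bs = [] \<longleftrightarrow> bs = []"
  by (auto simp: encs_def rev_map enc_def split: if_splits)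

lemma str_tape_conv: "str_tape x = T [] (encs x)"
  by (auto simp: str_tape_def T_def encs_def enc_def fun_eq_iff)

lemma tape_read_T [simp]:
  "tape_read (T l []) = 0" "tape_read (T l (a # r)) = a"
  by (auto simp: T_def nth_append)

lemma T_snoc_blank [simp]: "T l [0] = T l []"
  by (auto simp: T_def fun_eq_iff nth_append)

lemma tape_act_T [simp]:
  "tape_act (s, MRight) (T l (a # r)) = T (s # l) r"
  "tape_act (s, MRight) (T l []) = T (s # l) []"
  "tape_act (s, MStay) (T l (a # r)) = T l (s # r)"
  "tape_act (s, MStay) (T l []) = T l [s]"
  "tape_act (s, MLeft) (T (b # l) (a # r)) = T l (b # s # r)"
  "tape_act (0, MLeft) (T (b # l) []) = T l [b]"
  "tape_act (s, MLeft) (T [] (a # r)) = T_before (s # r)"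
  "tape_act (0, MLeft) (T [] []) = T_before []"
  by (auto simp: T_def T_before_def fun_eq_iff nth_append nth_Cons' nat_diff_distrib)

lemma tape_read_T_before [simp]: "tape_read (T_before r) = 0"
  by (simp add: T_before_def T_def)

lemma tape_act_T_before [simp]: "tape_act (0, MRight) (T_before r) = T [] r"
  by (auto simp: T_def T_before_def fun_eq_iff)

lemma T_before_blank [simp]: "T_before [0] = T_before []"
  by (simp add: T_before_def)

section \<open>Elementary tape programs and their running times\<close>

abbreviation one_act :: "nat \<Rightarrow> (nat \<Rightarrow> nat) \<Rightarrow> move \<Rightarrow> prog" where
  "one_act i g d \<equiv> Act (\<lambda>r. (stay r)(i := (g (r i), d)))"

definition rewind :: "nat \<Rightarrow> prog" where
  "rewind i = one_act i id MLeft ;; While (\<lambda>r. r i \<noteq> 0) (one_act i id MLeft) ;; one_act i id MRight"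

definition scan :: "nat \<Rightarrow> (nat \<Rightarrow> bool) \<Rightarrow> (nat \<Rightarrow> nat) \<Rightarrow> prog" where
  "scan i c g = While (\<lambda>r. c (r i)) (one_act i g MRight)"

definition copy :: "nat \<Rightarrow> nat \<Rightarrow> (nat \<Rightarrow> bool) \<Rightarrow> (nat \<Rightarrow> nat) \<Rightarrow> prog" where
  "copy i j c g =
     While (\<lambda>r. c (r i)) (Act (\<lambda>r. (stay r)(i := (r i, MRight), j := (g (r i), MRight))))"

definition erase :: "nat \<Rightarrow> prog" where
  "erase i = one_act i id MLeft ;; While (\<lambda>r. r i \<noteq> 0) (one_act i (\<lambda>_. 0) MLeft) ;; one_act i id MRight"

text \<open>The first move is unconditional because the head may stand on the blank after the
  contents. The loop then runs to cell -1, the first blank to the left as \<open>l\<close> contains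
  none, and the last move steps back to cell 0.\<close>

lemma runs_rewind:
  assumes "\<sigma> i = T l r" "0 \<notin> set l" "2 * length l + 4 \<le> t"
  shows "runs (rewind i) \<sigma> t (\<sigma>(i := T [] (rev l @ r)))"
proof -
  have loop: "runs (While (\<lambda>r. r i \<noteq> 0) (one_act i id MLeft)) \<sigma> (2 * length l + 3)
      (\<sigma>(i := T_before (rev l @ b # r)))"
    if "\<sigma> i = T l (b # r)" "b \<noteq> 0" "0 \<notin> set l" for \<sigma> l b r
    using that
  proof (induction l arbitrary: \<sigma> b r)
    case Nil
    have "runs (one_act i id MLeft) \<sigma> 1 (\<sigma>(i := T_before (b # r)))"
      by (rule runs_Act) (use Nil in auto)
    from runs_While_true[OF _ this runs_While_false[OF _ order.refl]] show ?case
      by (rule runs_cong) (use Nil in auto)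
  next
    case (Cons a l)
    have rest: "runs (While (\<lambda>r. r i \<noteq> 0) (one_act i id MLeft)) (\<sigma>(i := T l (a # b # r)))
      (2 * length l + 3) (\<sigma>(i := T l (a # b # r), i := T_before (rev l @ a # b # r)))"
      by (rule Cons.IH) (use Cons.prems in auto)
    have first: "runs (one_act i id MLeft) \<sigma> 1 (\<sigma>(i := T l (a # b # r)))"
      by (rule runs_Act) (use Cons.prems in auto)
    show ?case
      by (rule runs_cong[OF runs_While_true[OF _ first rest order.refl]]) (use Cons.prems in auto)
  qed
  define \<sigma>' where "\<sigma>' = acts ((stay (rd \<sigma>))(i := (id (rd \<sigma> i), MLeft))) \<sigma>"
  have first: "runs (one_act i id MLeft) \<sigma> 1 \<sigma>'"
    by (rule runs_Act) (auto simp: \<sigma>'_def)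
  have second: "runs (While (\<lambda>r. r i \<noteq> 0) (one_act i id MLeft)) \<sigma>' (2 * length l + 2)
      (\<sigma>(i := T_before (rev l @ r)))"
  proof (cases l)
    case Nil
    then have "\<sigma>' = \<sigma>(i := T_before r)"
      using assms by (cases r) (auto simp: \<sigma>'_def)
    then show ?thesis
      using Nil by (auto intro!: runs_While_false)
  next
    case (Cons a l')
    then have "\<sigma>' = \<sigma>(i := T l' (a # r))"
      using assms by (cases r) (auto simp: \<sigma>'_def)
    then show ?thesis
      using loop[of \<sigma>' l' a r] assms Cons by (auto intro: runs.weaken)
  qed
  have third: "runs (one_act i id MRight) (\<sigma>(i := T_before (rev l @ r))) 1 (\<sigma>(i := T [] (rev l @ r)))"
    by (rule runs_Act) auto
  show ?thesis unfolding rewind_def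
    by (rule runs_Seq[OF first runs_Seq[OF second third order.refl]]) (use assms in auto)
qed

lemma runs_scan:
  assumes "\<sigma> i = T l (xs @ ys)" "\<And>x. x \<in> set xs \<Longrightarrow> c x" "\<not> c (tape_read (T [] ys))"
    "2 * length xs + 1 \<le> t"
  shows "runs (scan i c g) \<sigma> t (\<sigma>(i := T (rev (map g xs) @ l) ys))"
  using assms
proof (induction xs arbitrary: \<sigma> l t)
  case Nil
  then have "\<not> c (rd \<sigma> i)" by (cases ys) auto
  then show ?case unfolding scan_def
    using runs_While_false[of "\<lambda>r. c (r i)" \<sigma> t] Nil by (simp add: fun_upd_idem)
next
  case (Cons x xs)
  have rest: "runs (While (\<lambda>r. c (r i)) (one_act i g MRight)) (\<sigma>(i := T (g x # l) (xs @ ys))) (2 * length xs + 1)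
    (\<sigma>(i := T (g x # l) (xs @ ys), i := T (rev (map g xs) @ g x # l) ys))"
    unfolding scan_def[symmetric] by (rule Cons.IH) (use Cons.prems in auto)
  have first: "runs (one_act i g MRight) \<sigma> 1 (\<sigma>(i := T (g x # l) (xs @ ys)))"
    by (rule runs_Act) (use Cons.prems in auto)
  show ?case unfolding scan_def
    by (rule runs_cong[OF runs_While_true[OF _ first rest order.refl]]) (use Cons.prems in auto)
qed

lemma runs_copy:
  assumes "\<sigma> i = T l (xs @ ys)" "\<sigma> j = T m []" "i \<noteq> j"
    "\<And>x. x \<in> set xs \<Longrightarrow> c x" "\<not> c (tape_read (T [] ys))" "2 * length xs + 1 \<le> t"
  shows "runs (copy i j c g) \<sigma> t (\<sigma>(i := T (rev xs @ l) ys, j := T (rev (map g xs) @ m) []))"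
  using assms
proof (induction xs arbitrary: \<sigma> l m t)
  case Nil
  then have "\<not> c (rd \<sigma> i)" by (cases ys) auto
  then show ?case unfolding copy_def
    using runs_While_false[of "\<lambda>r. c (r i)" \<sigma> t] Nil by (simp add: fun_upd_idem)
next
  case (Cons x xs)
  let ?\<sigma> = "\<sigma>(i := T (x # l) (xs @ ys), j := T (g x # m) [])"
  have rest: "runs (While (\<lambda>r. c (r i))
      (Act (\<lambda>r. (stay r)(i := (r i, MRight), j := (g (r i), MRight))))) ?\<sigma> (2 * length xs + 1)
    (?\<sigma>(i := T (rev xs @ x # l) ys, j := T (rev (map g xs) @ g x # m) []))"
    unfolding copy_def[symmetric] by (rule Cons.IH) (use Cons.prems in auto)
  have first: "runs (Act (\<lambda>r. (stay r)(i := (r i, MRight), j := (g (r i), MRight)))) \<sigma> 1 ?\<sigma>"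
    by (rule runs_Act) (use Cons.prems in auto)
  show ?case unfolding copy_def
    by (rule runs_cong[OF runs_While_true[OF _ first rest order.refl]])
      (use Cons.prems in \<open>auto simp: fun_eq_iff\<close>)
qed

lemma runs_erase:
  assumes "\<sigma> i = T l []" "0 \<notin> set l" "2 * length l + 4 \<le> t"
  shows "runs (erase i) \<sigma> t (\<sigma>(i := T [] []))"
proof -
  have loop: "runs (While (\<lambda>r. r i \<noteq> 0) (one_act i (\<lambda>_. 0) MLeft)) \<sigma> (2 * length l + 3)
      (\<sigma>(i := T_before []))"
    if "\<sigma> i = T l [b]" "b \<noteq> 0" "0 \<notin> set l" for \<sigma> l b
    using that
  proof (induction l arbitrary: \<sigma> b)
    case Nil
    have "runs (one_act i (\<lambda>_. 0) MLeft) \<sigma> 1 (\<sigma>(i := T_before []))"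
      by (rule runs_Act) (use Nil in auto)
    from runs_While_true[OF _ this runs_While_false[OF _ order.refl]] show ?case
      by (rule runs_cong) (use Nil in auto)
  next
    case (Cons a l)
    have *: "T l [a, 0] = T l [a]"
      by (auto simp: T_def fun_eq_iff nth_append nth_Cons')
    have first: "runs (one_act i (\<lambda>_. 0) MLeft) \<sigma> 1 (\<sigma>(i := T l [a]))"
      by (rule runs_Act) (use Cons.prems * in auto)
    have rest: "runs (While (\<lambda>r. r i \<noteq> 0) (one_act i (\<lambda>_. 0) MLeft)) (\<sigma>(i := T l [a]))
      (2 * length l + 3) (\<sigma>(i := T l [a], i := T_before []))"
      by (rule Cons.IH[of _ a]) (use Cons.prems in auto)
    show ?case
      by (rule runs_cong[OF runs_While_true[OF _ first rest order.refl]]) (use Cons.prems in auto)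
  qed
  define \<sigma>' where "\<sigma>' = acts ((stay (rd \<sigma>))(i := (id (rd \<sigma> i), MLeft))) \<sigma>"
  have first: "runs (one_act i id MLeft) \<sigma> 1 \<sigma>'"
    by (rule runs_Act) (auto simp: \<sigma>'_def)
  have second: "runs (While (\<lambda>r. r i \<noteq> 0) (one_act i (\<lambda>_. 0) MLeft)) \<sigma>' (2 * length l + 2)
      (\<sigma>(i := T_before []))"
  proof (cases l)
    case Nil
    then have "\<sigma>' = \<sigma>(i := T_before [])"
      using assms by (auto simp: \<sigma>'_def)
    then show ?thesis
      using Nil by (auto intro!: runs_While_false)
  next
    case (Cons a l')
    then have "\<sigma>' = \<sigma>(i := T l' [a])"
      using assms by (auto simp: \<sigma>'_def)
    then show ?thesis
      using loop[of \<sigma>' l' a] assms Cons by (auto intro: runs.weaken)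
  qed
  have third: "runs (one_act i id MRight) (\<sigma>(i := T_before [])) 1 (\<sigma>(i := T [] []))"
    by (rule runs_Act) auto
  show ?thesis unfolding erase_def
    by (rule runs_Seq[OF first runs_Seq[OF second third order.refl]]) (use assms in auto)
qed


section \<open>The generator\<close>

text \<open>Binary increment with the least significant bit first. Overflow wraps around to zeros,
  so a counter always occupies the same stretch of tape.\<close>

fun inc :: "bool list \<Rightarrow> bool list" where
  "inc [] = []"
| "inc (False # z) = True # z"
| "inc (True # z) = False # inc z"

text \<open>\<open>nor_eval ms l r b\<close> evaluates a straight-line program of NOR gates of unbounded fan-in. The mask
  of each gate has one bit per wire already computed, so that the concatenation \<open>ms\<close> of the masks
  needs no separators. The wires are \<open>rev l @ r\<close>, those in \<open>l\<close> have been scanned for the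
  current gate, and \<open>b\<close> is the disjunction of the selected ones so far.\<close>

function nor_eval :: "bool list \<Rightarrow> bool list \<Rightarrow> bool list \<Rightarrow> bool \<Rightarrow> bool" where
  "nor_eval [] l r b = (\<not> b)"
| "nor_eval (m # ms) l [] b = nor_eval (m # ms) [] (rev l @ [\<not> b]) False"
| "nor_eval (m # ms) l (v # r) b = nor_eval ms (v # l) r (b \<or> m \<and> v)"
  by pat_completeness auto
text \<open>Starting the next gate consumes no mask bit, but it makes the list of wires to scan
  nonempty. Hence mask bits count twice and an exhausted scan once.\<close>

termination
  by (relation "measure (\<lambda>(ms, l, r, b). 2 * length ms + (if r = [] then 1 else 0))") auto

text \<open>Inputs have the form \<open>replicate a False @ replicate N True @ False # ms\<close>.
  The leading zeros are the padding that lets a description be given any sufficiently large length,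
  and the arity \<open>N\<close> is written in unary.\<close>

definition arity_of :: "str \<Rightarrow> nat" where
  "arity_of u = length (takeWhile id (dropWhile Not u))"

definition masks_of :: "str \<Rightarrow> bool list" where
  "masks_of u = drop 1 (dropWhile id (dropWhile Not u))"

definition counter :: "nat \<Rightarrow> nat \<Rightarrow> bool list" where
  "counter N j = (inc ^^ j) (replicate N False)"

text \<open>Every input is meaningful: a mask list that breaks off inside a gate is still evaluated,
  and the counter wraps around from \<open>2 ^ N\<close> on, where \<open>N\<close> is the
  arity.\<close>

definition gen :: "str \<Rightarrow> str" where
  "gen u = map (\<lambda>j. nor_eval (masks_of u) [] (counter (arity_of u) j) False) [0..<Suc (length u)]"

text \<open>Roles of the tapes: 0 the input, later a unary clock; 1 the counter; 2 the wires; 3 the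
  masks; 4 the disjunction accumulated for the current gate; 5 the output.\<close>

definition gen_setup :: prog where
  "gen_setup = scan 0 (\<lambda>x. x = 1) id ;; copy 0 1 (\<lambda>x. x = 2) (\<lambda>_. 1) ;;
     Act (\<lambda>r. (stay r)(0 := (r 0, if r 0 = 0 then MStay else MRight))) ;;
     copy 0 3 (\<lambda>x. x \<noteq> 0) id ;; rewind 0 ;; rewind 1 ;; rewind 3"

definition gen_scan :: prog where
  "gen_scan = Act (\<lambda>r. (stay r)(4 := (if r 2 = 2 \<and> r 3 = 2 then 1 else r 4, MStay),
      2 := (r 2, MRight), 3 := (r 3, MRight)))"

definition gen_gate :: prog where
  "gen_gate = Act (\<lambda>r. (stay r)(2 := (if r 4 = 0 then 2 else 1, MStay), 4 := (0, MStay))) ;; rewind 2"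

definition gen_eval :: prog where
  "gen_eval = While (\<lambda>r. r 3 \<noteq> 0) (Cond (\<lambda>r. r 2 \<noteq> 0) gen_scan gen_gate)"

definition gen_write :: prog where
  "gen_write = Act (\<lambda>r. (stay r)(5 := (if r 4 = 0 then 2 else 1, MRight), 4 := (0, MStay)))"

definition gen_body :: prog where
  "gen_body = copy 1 2 (\<lambda>x. x \<noteq> 0) id ;; rewind 1 ;; rewind 2 ;; gen_eval ;; gen_write ;;
     scan 2 (\<lambda>x. x \<noteq> 0) id ;; erase 2 ;; rewind 3 ;;
     scan 1 (\<lambda>x. x = 2) (\<lambda>_. 1) ;; one_act 1 (\<lambda>x. if x = 1 then 2 else x) MStay ;; rewind 1"

text \<open>Each round of \<open>gen_body\<close> writes one bit. The loop makes one round per input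
  bit, and the round before it supplies the additional bit that makes the output longer than the
  input.\<close>

definition gen_prog :: prog where
  "gen_prog = gen_setup ;; gen_body ;;
     While (\<lambda>r. r 0 \<noteq> 0) (gen_body ;; one_act 0 id MRight) ;; rewind 5"

section \<open>Correctness and running time of the generator program\<close>

definition St :: "tape \<Rightarrow> tape \<Rightarrow> tape \<Rightarrow> tape \<Rightarrow> tape \<Rightarrow> tape \<Rightarrow> store" where
  "St t0 t1 t2 t3 t4 t5 = (\<lambda>_. str_tape [])(0 := t0, 1 := t1, 2 := t2, 3 := t3, 4 := t4, 5 := t5)"

lemma St_apply [simp]:
  "St t0 t1 t2 t3 t4 t5 0 = t0" "St t0 t1 t2 t3 t4 t5 1 = t1" "St t0 t1 t2 t3 t4 t5 (Suc 0) = t1"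
  "St t0 t1 t2 t3 t4 t5 2 = t2"
  "St t0 t1 t2 t3 t4 t5 3 = t3" "St t0 t1 t2 t3 t4 t5 4 = t4" "St t0 t1 t2 t3 t4 t5 5 = t5"
  by (auto simp: St_def)

lemma St_upd [simp]:
  "(St t0 t1 t2 t3 t4 t5)(0 := t) = St t t1 t2 t3 t4 t5"
  "(St t0 t1 t2 t3 t4 t5)(1 := t) = St t0 t t2 t3 t4 t5"
  "(St t0 t1 t2 t3 t4 t5)(Suc 0 := t) = St t0 t t2 t3 t4 t5"
  "(St t0 t1 t2 t3 t4 t5)(2 := t) = St t0 t1 t t3 t4 t5"
  "(St t0 t1 t2 t3 t4 t5)(3 := t) = St t0 t1 t2 t t4 t5"
  "(St t0 t1 t2 t3 t4 t5)(4 := t) = St t0 t1 t2 t3 t t5"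
  "(St t0 t1 t2 t3 t4 t5)(5 := t) = St t0 t1 t2 t3 t4 t"
  by (auto simp: St_def fun_eq_iff)

abbreviation flag :: "bool \<Rightarrow> tape" where
  "flag b \<equiv> T [] [bitc b]"

text \<open>The potential bounded by \<open>W\<close> never increases: a wire is appended only when
  a scan is exhausted, and mask bits consumed earlier have paid for it. So \<open>W\<close> bounds
  the wire tape throughout and with it the cost of each rewind, while the termination measure of
  \<open>nor_eval\<close> bounds the number of iterations.\<close>

lemma runs_gen_eval:
  assumes "length l + length r + 2 * length ms + (if r = [] then 1 else 0) \<le> W"
  shows "\<exists>l' r' b'. length l' + length r' \<le> W \<and> nor_eval ms l r b = (\<not> b') \<and>
    runs gen_eval (St t0 t1 (T (encs l) (encs r)) (T (encs k) (encs ms)) (flag b) t5)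
      (Suc ((2 * length ms + (if r = [] then 1 else 0)) * (2 * W + 8)))
      (St t0 t1 (T (encs l') (encs r')) (T (encs (rev ms @ k)) []) (flag b') t5)"
  using assms
proof (induction ms l r b arbitrary: k rule: nor_eval.induct)
  case (1 l r b)
  have "runs gen_eval (St t0 t1 (T (encs l) (encs r)) (T (encs k) []) (flag b) t5) 1
     (St t0 t1 (T (encs l) (encs r)) (T (encs k) []) (flag b) t5)"
    unfolding gen_eval_def by (rule runs_While_false) auto
  moreover have "length l + length r \<le> W" using 1 by simp
  ultimately show ?case by (intro exI[of _ l] exI[of _ r] exI[of _ b]) (auto intro: runs.weaken)
next
  case (2 m ms l b)
  let ?t3 = "T (encs k) (encs (m # ms))"
  let ?\<sigma> = "St t0 t1 (T (encs l) []) ?t3 (flag b) t5"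
  let ?\<tau> = "St t0 t1 (T [] (encs (rev l @ [\<not> b]))) ?t3 (flag False) t5"
  obtain l' r' b' where IH: "length l' + length r' \<le> W"
      "nor_eval (m # ms) [] (rev l @ [\<not> b]) False = (\<not> b')"
    "runs gen_eval ?\<tau> (Suc (2 * length (m # ms) * (2 * W + 8)))
      (St t0 t1 (T (encs l') (encs r')) (T (encs (rev (m # ms) @ k)) []) (flag b') t5)"
    using 2(1)[of k] 2(2) by fastforce
  have "runs (Act (\<lambda>r. (stay r)(2 := (if r 4 = 0 then 2 else 1, MStay), 4 := (0, MStay)))) ?\<sigma> 1
    (St t0 t1 (T (encs l) (encs [\<not> b])) ?t3 (flag False) t5)"
    by (rule runs_Act) (auto simp: bitc_def enc_def)
  moreover have "runs (rewind 2) (St t0 t1 (T (encs l) (encs [\<not> b])) ?t3 (flag False) t5)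
    (2 * length l + 4) ?\<tau>"
    by (rule runs_cong[OF runs_rewind[OF _ _ order.refl]]) auto
  ultimately have gate: "runs gen_gate ?\<sigma> (2 * length l + 5) ?\<tau>"
    unfolding gen_gate_def by (rule runs_Seq) auto
  have cond: "runs (Cond (\<lambda>r. r 2 \<noteq> 0) gen_scan gen_gate) ?\<sigma> (2 * length l + 6) ?\<tau>"
    by (rule runs_If_false[OF _ gate]) auto
  have "runs gen_eval ?\<sigma> (Suc ((2 * length (m # ms) + 1) * (2 * W + 8)))
     (St t0 t1 (T (encs l') (encs r')) (T (encs (rev (m # ms) @ k)) []) (flag b') t5)"
    unfolding gen_eval_def
    by (rule runs_While_true[OF _ cond IH(3)[unfolded gen_eval_def]]) (use 2(2) in auto)
  then show ?case using IH(1,2) by auto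
next
  case (3 m ms l v r b)
  let ?\<sigma> = "St t0 t1 (T (encs l) (encs (v # r))) (T (encs k) (encs (m # ms))) (flag b) t5"
  let ?\<tau> = "St t0 t1 (T (encs (v # l)) (encs r)) (T (encs (m # k)) (encs ms)) (flag (b \<or> m \<and> v)) t5"
  have "length (v # l) + length r + 2 * length ms + (if r = [] then 1 else 0) \<le> W"
    using 3(2) by auto
  from 3(1)[OF this, of "m # k"]
  obtain l' r' b' where IH: "length l' + length r' \<le> W"
      "nor_eval ms (v # l) r (b \<or> m \<and> v) = (\<not> b')"
    "runs gen_eval ?\<tau> (Suc ((2 * length ms + (if r = [] then 1 else 0)) * (2 * W + 8)))
      (St t0 t1 (T (encs l') (encs r')) (T (encs (rev ms @ m # k)) []) (flag b') t5)"
    by auto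
  have "runs gen_scan ?\<sigma> 1 ?\<tau>"
    unfolding gen_scan_def by (rule runs_Act) (auto simp: bitc_def)
  then have cond: "runs (Cond (\<lambda>r. r 2 \<noteq> 0) gen_scan gen_gate) ?\<sigma> 2 ?\<tau>"
    by (rule runs_If_true[rotated]) auto
  have "runs gen_eval ?\<sigma> (Suc (2 * length (m # ms) * (2 * W + 8)))
      (St t0 t1 (T (encs l') (encs r')) (T (encs (rev ms @ m # k)) []) (flag b') t5)"
    unfolding gen_eval_def
    by (rule runs_While_true[OF _ cond IH(3)[unfolded gen_eval_def]]) auto
  then show ?case using IH(1,2) by auto
qed

lemma length_inc [simp]: "length (inc z) = length z"
  by (induction z rule: inc.induct) auto

text \<open>Incrementing clears the initial run of ones and sets the zero after it. If there is no
  such zero, the head stands on the blank, which is left alone: this is the wrap-around.\<close>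

lemma runs_inc:
  assumes "6 * length z + 20 \<le> t"
  shows "runs (scan 1 (\<lambda>x. x = 2) (\<lambda>_. 1) ;; one_act 1 (\<lambda>x. if x = 1 then 2 else x) MStay ;; rewind 1)
    (St t0 (T [] (encs z)) t2 t3 t4 t5) t (St t0 (T [] (encs (inc z))) t2 t3 t4 t5)"
proof -
  define n where "n = length (takeWhile id z)"
  define y where "y = dropWhile id z"
  have z: "z = replicate n True @ y"
  proof -
    have "takeWhile id z = replicate n True"
      unfolding n_def by (rule replicate_eqI) (auto dest: set_takeWhileD)
    then show ?thesis using takeWhile_dropWhile_id[of id z] by (simp add: y_def)
  qed
  have y: "y = [] \<or> (\<exists>y'. y = False # y')"
    unfolding y_def using hd_dropWhile[of id z] by (cases "dropWhile id z") auto
  have inc: "inc z = replicate n False @ (case y of [] \<Rightarrow> [] | b # y' \<Rightarrow> True # y')"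
  proof -
    have "inc (replicate n True @ y) = replicate n False @ inc y"
      by (induction n) auto
    then show ?thesis unfolding z using y by auto
  qed
  have 1: "runs (scan 1 (\<lambda>x. x = 2) (\<lambda>_. 1)) (St t0 (T [] (encs z)) t2 t3 t4 t5) (2 * n + 1)
     (St t0 (T (encs (replicate n False)) (encs y)) t2 t3 t4 t5)"
    by (rule runs_cong[OF runs_scan[where xs = "replicate n 2" and ys = "encs y" and l = "[]", OF _ _ _ order.refl]])
      (use y in \<open>auto simp: z encs_def enc_def map_replicate\<close>)
  have 2: "runs (one_act 1 (\<lambda>x. if x = 1 then 2 else x) MStay)
     (St t0 (T (encs (replicate n False)) (encs y)) t2 t3 t4 t5) 1
     (St t0 (T (encs (replicate n False)) (encs (case y of [] \<Rightarrow> [] | b # y' \<Rightarrow> True # y'))) t2 t3 t4 t5)"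
    by (rule runs_Act) (use y in \<open>auto simp: enc_def\<close>)
  have 3: "runs (rewind 1)
     (St t0 (T (encs (replicate n False)) (encs (case y of [] \<Rightarrow> [] | b # y' \<Rightarrow> True # y'))) t2 t3 t4 t5)
     (2 * n + 4) (St t0 (T [] (encs (inc z))) t2 t3 t4 t5)"
    by (rule runs_cong[OF runs_rewind[OF _ _ order.refl]]) (auto simp: inc)
  show ?thesis
    by (rule runs.weaken[OF runs.seq[OF 1 runs.seq[OF 2 3]]]) (use assms in \<open>auto simp: z\<close>)
qed

lemma runs_gen_body:
  assumes W: "W = length z + 2 * length ms + 1"
    and t: "(2 * W + 8) * (2 * W + 8) \<le> t"
  shows "runs gen_body (St t0 (T [] (encs z)) (T [] []) (T [] (encs ms)) (flag False) (T o' [])) t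
    (St t0 (T [] (encs (inc z))) (T [] []) (T [] (encs ms)) (flag False)
       (T (enc (nor_eval ms [] z False) # o') []))"
proof -
  let ?ms = "T [] (encs ms)" and ?o = "T o' []"
  have 1: "runs (copy 1 2 (\<lambda>x. x \<noteq> 0) id) (St t0 (T [] (encs z)) (T [] []) ?ms (flag False) ?o)
    (2 * length z + 1) (St t0 (T (encs (rev z)) []) (T (encs (rev z)) []) ?ms (flag False) ?o)"
    by (rule runs_cong[OF runs_copy[where xs = "encs z" and ys = "[]" and l = "[]" and m = "[]", OF _ _ _ _ _ order.refl]])
      (auto simp: encs_def rev_map)
  have 2: "runs (rewind 1) (St t0 (T (encs (rev z)) []) (T (encs (rev z)) []) ?ms (flag False) ?o)
    (2 * length z + 4) (St t0 (T [] (encs z)) (T (encs (rev z)) []) ?ms (flag False) ?o)"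
    by (rule runs_cong[OF runs_rewind[OF _ _ order.refl]]) auto
  have 3: "runs (rewind 2) (St t0 (T [] (encs z)) (T (encs (rev z)) []) ?ms (flag False) ?o)
    (2 * length z + 4) (St t0 (T [] (encs z)) (T [] (encs z)) ?ms (flag False) ?o)"
    by (rule runs_cong[OF runs_rewind[OF _ _ order.refl]]) auto
  have "length [] + length z + 2 * length ms + (if z = [] then 1 else 0) \<le> W" using W by simp
  from runs_gen_eval[OF this, of False t0 "T [] (encs z)" "[]" ?o]
  obtain l r b where W': "length l + length r \<le> W" and b: "nor_eval ms [] z False = (\<not> b)"
    and 4: "runs gen_eval (St t0 (T [] (encs z)) (T [] (encs z)) ?ms (flag False) ?o)
      (Suc ((2 * length ms + (if z = [] then 1 else 0)) * (2 * W + 8)))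
      (St t0 (T [] (encs z)) (T (encs l) (encs r)) (T (encs (rev ms)) []) (flag b) ?o)"
    by auto
  let ?o' = "T (enc (\<not> b) # o') []"
  have 5: "runs gen_write (St t0 (T [] (encs z)) (T (encs l) (encs r)) (T (encs (rev ms)) []) (flag b) ?o) 1
    (St t0 (T [] (encs z)) (T (encs l) (encs r)) (T (encs (rev ms)) []) (flag False) ?o')"
    unfolding gen_write_def by (rule runs_Act) (auto simp: bitc_def enc_def)
  \<comment> \<open>The evaluation stops somewhere in the middle of the wires, whereas
    \<open>erase\<close> has to start at their right end.\<close>
  have 6: "runs (scan 2 (\<lambda>x. x \<noteq> 0) id)
    (St t0 (T [] (encs z)) (T (encs l) (encs r)) (T (encs (rev ms)) []) (flag False) ?o') (2 * length r + 1)
    (St t0 (T [] (encs z)) (T (encs (rev r @ l)) []) (T (encs (rev ms)) []) (flag False) ?o')"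
    by (rule runs_cong[OF runs_scan[where xs = "encs r" and ys = "[]" and l = "encs l", OF _ _ _ order.refl]])
      (auto simp: encs_def rev_map)
  have 7: "runs (erase 2)
    (St t0 (T [] (encs z)) (T (encs (rev r @ l)) []) (T (encs (rev ms)) []) (flag False) ?o')
    (2 * length (encs (rev r @ l)) + 4)
    (St t0 (T [] (encs z)) (T [] []) (T (encs (rev ms)) []) (flag False) ?o')"
    by (rule runs_cong[OF runs_erase[OF _ _ order.refl]]) auto
  have 8: "runs (rewind 3)
    (St t0 (T [] (encs z)) (T [] []) (T (encs (rev ms)) []) (flag False) ?o') (2 * length ms + 4)
    (St t0 (T [] (encs z)) (T [] []) (T [] (encs ms)) (flag False) ?o')"
    by (rule runs_cong[OF runs_rewind[OF _ _ order.refl]]) auto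
  note 9 = runs_inc[OF order.refl, where z = z and ?t0.0 = t0 and ?t2.0 = "T [] []" and ?t3.0 = "T [] (encs ms)"
      and ?t4.0 = "flag False" and ?t5.0 = ?o']
  have "(2 * length ms + (if z = [] then 1 else 0)) * (2 * W + 8) \<le> W * (2 * W + 8)"
    by (rule mult_right_mono) (use W in auto)
  then have "2 * length z + 1 + (2 * length z + 4 + (2 * length z + 4 + (Suc ((2 * length ms +
     (if z = [] then 1 else 0)) * (2 * W + 8)) + (1 + (2 * length r + 1 + (2 * length (encs (rev r @ l)) + 4 +
      (2 * length ms + 4 + (6 * length z + 20)))))))) \<le> W * (2 * W + 8) + 16 * W + 40"
    using W' W by simp
  also have "\<dots> \<le> (2 * W + 8) * (2 * W + 8)"
    by (simp add: algebra_simps)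
  finally show ?thesis unfolding gen_body_def b
    using runs.seq[OF 1 runs.seq[OF 2 runs.seq[OF 3 runs.seq[OF 4 runs.seq[OF 5 runs.seq[OF 6
      runs.seq[OF 7 runs.seq[OF 8 9]]]]]]]] t
    by (meson order.trans runs.weaken)
qed

lemma runs_gen_loop:
  assumes W: "W = length z + 2 * length ms + 1"
  shows "runs (While (\<lambda>r. r 0 \<noteq> 0) (gen_body ;; one_act 0 id MRight))
    (St (T k (encs us)) (T [] (encs z)) (T [] []) (T [] (encs ms)) (flag False) (T o' []))
    (length us * ((2 * W + 8) * (2 * W + 8) + 2) + 1)
    (St (T (encs (rev us) @ k) []) (T [] (encs ((inc ^^ length us) z))) (T [] []) (T [] (encs ms)) (flag False)
       (T (encs (rev (map (\<lambda>j. nor_eval ms [] ((inc ^^ j) z) False) [0..<length us])) @ o') []))"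
  using assms
proof (induction us arbitrary: k z o')
  case Nil
  show ?case by (rule runs_cong[OF runs_While_false]) auto
next
  case (Cons u us)
  let ?B = "(2 * W + 8) * (2 * W + 8)"
  let ?o' = "T (enc (nor_eval ms [] z False) # o') []"
  have 1: "runs gen_body
     (St (T k (encs (u # us))) (T [] (encs z)) (T [] []) (T [] (encs ms)) (flag False) (T o' [])) ?B
     (St (T k (encs (u # us))) (T [] (encs (inc z))) (T [] []) (T [] (encs ms)) (flag False) ?o')"
    by (rule runs_gen_body[OF Cons.prems]) simp
  have 2: "runs (one_act 0 id MRight)
     (St (T k (encs (u # us))) (T [] (encs (inc z))) (T [] []) (T [] (encs ms)) (flag False) ?o') 1
     (St (T (enc u # k) (encs us)) (T [] (encs (inc z))) (T [] []) (T [] (encs ms)) (flag False) ?o')"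
    by (rule runs_Act) auto
  have "W = length (inc z) + 2 * length ms + 1" using Cons.prems by simp
  note 3 = Cons.IH[OF this, of "enc u # k" "enc (nor_eval ms [] z False) # o'"]
  \<comment> \<open>Splits off the first round; the remaining ones start from \<open>inc z\<close>,
    which shifts the index by one.\<close>
  have "[0..<length (u # us)] = 0 # map Suc [0..<length us]"
    by (simp add: upt_conv_Cons map_Suc_upt del: upt_Suc)
  then have "map (\<lambda>j. nor_eval ms [] ((inc ^^ j) z) False) [0..<length (u # us)]
    = nor_eval ms [] z False # map (\<lambda>j. nor_eval ms [] ((inc ^^ j) (inc z)) False) [0..<length us]"
    by (simp add: funpow_swap1 del: upt_Suc)
  then have o: "encs (rev (map (\<lambda>j. nor_eval ms [] ((inc ^^ j) z) False) [0..<length (u # us)])) @ o'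
    = encs (rev (map (\<lambda>j. nor_eval ms [] ((inc ^^ j) (inc z)) False) [0..<length us]))
       @ enc (nor_eval ms [] z False) # o'" by simp
  show ?case unfolding o
    by (rule runs_cong[OF runs_While_true[OF _ runs.seq[OF 1 2] 3 order.refl]])
     (auto simp: funpow_swap1)
qed

lemma runs_gen_setup:
  "runs gen_setup (St (T [] (encs u)) (T [] []) (T [] []) (T [] []) (flag False) (T [] []))
     (12 * length u + 20)
     (St (T [] (encs u)) (T [] (encs (replicate (arity_of u) False))) (T [] []) (T [] (encs (masks_of u)))
        (flag False) (T [] []))"
proof -
  define v where "v = dropWhile Not u"
  define m where "m = length (takeWhile Not u)"
  define n where "n = arity_of u"
  define w where "w = dropWhile id v"
  have "takeWhile Not u = replicate m False"
    unfolding m_def by (rule replicate_eqI) (auto dest: set_takeWhileD)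
  then have u: "u = replicate m False @ v"
    using takeWhile_dropWhile_id[of Not u] by (simp add: v_def)
  have "takeWhile id v = replicate n True"
    unfolding n_def arity_of_def v_def by (rule replicate_eqI) (auto dest: set_takeWhileD)
  then have v: "v = replicate n True @ w"
    using takeWhile_dropWhile_id[of id v] by (simp add: w_def)
  have v': "v = [] \<or> (\<exists>v'. v = True # v')"
    unfolding v_def using hd_dropWhile[of Not u] by (cases "dropWhile Not u") auto
  have w': "w = [] \<or> (\<exists>w'. w = False # w')"
    unfolding w_def using hd_dropWhile[of id v] by (cases "dropWhile id v") auto
  have masks: "masks_of u = drop 1 w" by (simp add: masks_of_def w_def v_def)
  let ?l = "replicate n True @ replicate m False"
  let ?n = "T (encs (replicate n False)) []"
  have 1: "runs (scan 0 (\<lambda>x. x = 1) id) (St (T [] (encs u)) (T [] []) (T [] []) (T [] []) (flag False) (T [] []))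
     (2 * m + 1) (St (T (encs (replicate m False)) (encs v)) (T [] []) (T [] []) (T [] []) (flag False) (T [] []))"
    by (rule runs_cong[OF runs_scan[where xs = "replicate m 1" and ys = "encs v" and l = "[]", OF _ _ _ order.refl]])
      (use v' in \<open>auto simp: u encs_def enc_def map_replicate\<close>)
  have 2: "runs (copy 0 1 (\<lambda>x. x = 2) (\<lambda>_. 1))
     (St (T (encs (replicate m False)) (encs v)) (T [] []) (T [] []) (T [] []) (flag False) (T [] []))
     (2 * n + 1) (St (T (encs ?l) (encs w)) ?n (T [] []) (T [] []) (flag False) (T [] []))"
    by (rule runs_cong[OF runs_copy[where xs = "replicate n 2" and ys = "encs w" and m = "[]"
        and l = "encs (replicate m False)", OF _ _ _ _ _ order.refl]])
      (use w' in \<open>auto simp: v encs_def enc_def map_replicate\<close>)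
  \<comment> \<open>Skips the separator after the run of ones. An input may end with that run; then
    \<open>w\<close> is empty and the head stays.\<close>
  have 3: "runs (Act (\<lambda>r. (stay r)(0 := (r 0, if r 0 = 0 then MStay else MRight))))
     (St (T (encs ?l) (encs w)) ?n (T [] []) (T [] []) (flag False) (T [] [])) 1
     (St (T (encs (rev (take 1 w) @ ?l)) (encs (drop 1 w))) ?n (T [] []) (T [] []) (flag False) (T [] []))"
    by (rule runs_Act) (use w' in auto)
  have 4: "runs (copy 0 3 (\<lambda>x. x \<noteq> 0) id)
     (St (T (encs (rev (take 1 w) @ ?l)) (encs (drop 1 w))) ?n (T [] []) (T [] []) (flag False) (T [] []))
     (2 * length (encs (drop 1 w)) + 1)
     (St (T (encs (rev u)) []) ?n (T [] []) (T (encs (rev (drop 1 w))) []) (flag False) (T [] []))"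
    by (rule runs_cong[OF runs_copy[where xs = "encs (drop 1 w)" and ys = "[]" and m = "[]"
        and l = "encs (rev (take 1 w) @ ?l)", OF _ _ _ _ _ order.refl]])
      (use w' encs_simps(6) in \<open>auto simp: u v intro: gr0I\<close>)
  have 5: "runs (rewind 0)
     (St (T (encs (rev u)) []) ?n (T [] []) (T (encs (rev (drop 1 w))) []) (flag False) (T [] []))
     (2 * length u + 4)
     (St (T [] (encs u)) ?n (T [] []) (T (encs (rev (drop 1 w))) []) (flag False) (T [] []))"
    by (rule runs_cong[OF runs_rewind[OF _ _ order.refl]]) auto
  have 6: "runs (rewind 1)
     (St (T [] (encs u)) ?n (T [] []) (T (encs (rev (drop 1 w))) []) (flag False) (T [] []))
     (2 * n + 4)
     (St (T [] (encs u)) (T [] (encs (replicate n False))) (T [] []) (T (encs (rev (drop 1 w))) []) (flag False) (T [] []))"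
    by (rule runs_cong[OF runs_rewind[OF _ _ order.refl]]) auto
  have 7: "runs (rewind 3)
     (St (T [] (encs u)) (T [] (encs (replicate n False))) (T [] []) (T (encs (rev (drop 1 w))) []) (flag False) (T [] []))
     (2 * length w + 4)
     (St (T [] (encs u)) (T [] (encs (replicate n False))) (T [] []) (T [] (encs (drop 1 w))) (flag False) (T [] []))"
    by (rule runs_cong[OF runs_rewind[OF _ _ order.refl]]) auto
  show ?thesis unfolding gen_setup_def masks n_def[symmetric]
    by (rule runs.weaken[OF runs.seq[OF 1 runs.seq[OF 2 runs.seq[OF 3 runs.seq[OF 4 runs.seq[OF 5
      runs.seq[OF 6 7]]]]]]]) (auto simp: u v)
qed

lemma arity_masks_le: "arity_of u + length (masks_of u) \<le> length u"
proof -
  have "length (takeWhile id v) + length (drop 1 (dropWhile id v)) \<le> length v" for v :: "bool list"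
    by (induction v) auto
  from this[of "dropWhile Not u"] show ?thesis
    unfolding arity_of_def masks_of_def using length_dropWhile_le[of Not u] by linarith
qed

lemma init_store_St:
  "init_store u = St (T [] (encs u)) (T [] []) (T [] []) (T [] []) (flag False) (T [] [])"
  by (auto simp: init_store_def St_def str_tape_conv bitc_def fun_eq_iff)

lemma runs_gen_prog:
  "\<exists>\<tau>. runs gen_prog (init_store u) (100 * (length u + 3) ^ 3) \<tau> \<and> \<tau> 5 = str_tape (gen u)"
proof -
  let ?z = "replicate (arity_of u) False" and ?ms = "masks_of u"
  define W where "W = length ?z + 2 * length ?ms + 1"
  define L where "L = length u"
  let ?B = "(2 * W + 8) * (2 * W + 8)"
  let ?E = "\<lambda>j. nor_eval ?ms [] ((inc ^^ j) ?z) False"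
  note prep = runs_gen_setup[of u, folded init_store_St]
  note body = runs_gen_body[OF W_def order.refl, of "T [] (encs u)" "[]"]
  have W': "W = length (inc ?z) + 2 * length ?ms + 1" by (simp add: W_def)
  have "gen u = ?E 0 # map (\<lambda>j. nor_eval ?ms [] ((inc ^^ j) (inc ?z)) False) [0..<length u]"
  proof -
    have "[0..<Suc (length u)] = 0 # map Suc [0..<length u]"
      by (simp add: upt_conv_Cons map_Suc_upt del: upt_Suc)
    then show ?thesis
      by (simp add: gen_def counter_def funpow_swap1 del: upt_Suc)
  qed
  then have out: "encs (rev (gen u)) =
      encs (rev (map (\<lambda>j. nor_eval ?ms [] ((inc ^^ j) (inc ?z)) False) [0..<length u])) @ [enc (?E 0)]"
    by simp
  let ?t = "St (T (encs (rev u)) []) (T [] (encs ((inc ^^ length u) (inc ?z)))) (T [] []) (T [] (encs ?ms))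
     (flag False)"
  have loop: "runs (While (\<lambda>r. r 0 \<noteq> 0) (gen_body ;; one_act 0 id MRight))
      (St (T [] (encs u)) (T [] (encs (inc ?z))) (T [] []) (T [] (encs ?ms)) (flag False)
        (T [enc (nor_eval ?ms [] ?z False)] []))
      (length u * (?B + 2) + 1) (?t (T (encs (rev (gen u))) []))"
    by (rule runs_cong[OF runs_gen_loop[OF W']]) (simp_all add: out)
  have rew: "runs (rewind 5) (?t (T (encs (rev (gen u))) [])) (2 * length u + 6) (?t (T [] (encs (gen u))))"
    by (rule runs_cong[OF runs_rewind[OF _ _ order.refl]]) (auto simp: gen_def)
  have "runs gen_prog (init_store u)
    ((12 * L + 20) + (?B + ((L * (?B + 2) + 1) + (2 * L + 6)))) (?t (T [] (encs (gen u))))"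
    unfolding gen_prog_def L_def
    by (rule runs.seq[OF prep runs.seq[OF body runs.seq[OF loop rew]]])
  moreover have "(12 * L + 20) + (?B + ((L * (?B + 2) + 1) + (2 * L + 6))) \<le> 100 * (L + 3) ^ 3"
  proof -
    \<comment> \<open>Arity and masks are disjoint parts of the input, so
      \<open>W \<le> 2 * L + 1\<close>; each of the \<open>L + 1\<close> rounds takes quadratic
      time.\<close>
    have "2 * W + 8 \<le> 4 * L + 10"
      using arity_masks_le[of u] by (simp add: W_def L_def)
    then have "?B \<le> (4 * L + 10) * (4 * L + 10)" by (intro mult_mono) auto
    then have "?B + L * (?B + 2) \<le> (4 * L + 10) * (4 * L + 10) + L * ((4 * L + 10) * (4 * L + 10) + 2)"
      by (meson add_mono add_le_mono1 mult_le_mono2)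
    then show ?thesis by (simp add: power3_eq_cube algebra_simps)
  qed
  ultimately show ?thesis
    unfolding L_def
    by (intro exI[of _ "?t (T [] (encs (gen u)))"] conjI) (auto intro: runs.weaken simp: str_tape_conv)
qed

lemma wf_act_stay_upd:
  assumes "wf_act k S a" "i < k" "\<And>r. (\<forall>i. r i < S) \<Longrightarrow> fst (x r) < S"
  shows "wf_act k S (\<lambda>r. (a r)(i := x r))"
  using assms by (auto simp: wf_act_def)

lemma wf_prog_tape_ops:
  assumes "i < k"
  shows "wf_prog k S (rewind i)" "0 < S \<Longrightarrow> wf_prog k S (erase i)"
    "(\<And>x. x < S \<Longrightarrow> g x < S) \<Longrightarrow> wf_prog k S (one_act i g d)"
    "(\<And>x. x < S \<Longrightarrow> g x < S) \<Longrightarrow> wf_prog k S (scan i c g)"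
    "j < k \<Longrightarrow> (\<And>x. x < S \<Longrightarrow> g x < S) \<Longrightarrow> wf_prog k S (copy i j c g)"
  using assms
  by (auto simp: rewind_def erase_def scan_def copy_def intro!: wf_act_stay_upd wf_act_stay)

lemma polytime_gen: "polytime_computable gen"
proof -
  have "wf_prog 6 3 gen_prog"
    by (auto simp: gen_prog_def gen_setup_def gen_body_def gen_eval_def gen_scan_def gen_gate_def gen_write_def
        intro!: wf_prog_tape_ops wf_act_stay_upd wf_act_stay)
  moreover obtain \<tau> where "\<And>u. runs gen_prog (init_store u) (poly (smult 100 ([:3, 1:] ^ 3)) (length u)) (\<tau> u)"
      "\<And>u. \<tau> u 5 = str_tape (gen u)"
    using runs_gen_prog by (simp add: poly_power add.commute) metis
  ultimately show ?thesis
    by (intro polytime_computable_if_runs[where k = 6 and S = 3 and \<tau> = \<tau> and q = "smult 100 ([:3, 1:] ^ 3)"]) auto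
qed

lemma proof_complexity_generator_gen: "proof_complexity_generator gen"
  unfolding proof_complexity_generator_def by (intro exI[of _ Suc]) (simp add: gen_def)


section \<open>Looking up a bit of a polynomial-time function\<close>

fun val :: "bool list \<Rightarrow> nat" where
  "val [] = 0"
| "val (b # z) = of_bool b + 2 * val z"

text \<open>The argument of \<open>f\<close> depends on \<open>z\<close> only through its length, so
  on the inputs of one length the language is the table of a single string. Indices beyond its end
  are rejected.\<close>

definition lookup_lang :: "(str \<Rightarrow> str) \<Rightarrow> nat \<Rightarrow> str set" where
  "lookup_lang f K = {z. val z < length (f (replicate (length z ^ K) True)) \<and>
     f (replicate (length z ^ K) True) ! val z}"

subsection \<open>Configurations of a well-formed machine\<close>

definition good_config :: "tm \<Rightarrow> config \<Rightarrow> bool" where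
  "good_config M c \<longleftrightarrow> fst c \<le> tm_states M \<and> length (snd c) = tm_tapes M \<and>
     (\<forall>t \<in> set (snd c). \<forall>j. snd t j < tm_symbols M)"

lemma good_config_init: "wf_tm M \<Longrightarrow> good_config M (tm_init M x)"
  by (auto simp: good_config_def tm_init_def wf_tm_def str_tape_def)

lemma wf_tm_delta:
  assumes "wf_tm M" "good_config M (q, ts)" "q < tm_states M"
    and "tm_delta M q (map tape_read ts) = (q', ms)"
  shows "q' \<le> tm_states M" "length ms = tm_tapes M" "\<And>m. m \<in> set ms \<Longrightarrow> fst m < tm_symbols M"
proof -
  have "length (map tape_read ts) = tm_tapes M" "set (map tape_read ts) \<subseteq> {..<tm_symbols M}"
    using assms(2) by (auto simp: good_config_def tape_read_conv)
  then have "q' \<le> tm_states M \<and> length ms = tm_tapes M \<and> fst ` set ms \<subseteq> {..<tm_symbols M}"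
    using assms unfolding wf_tm_def by fastforce
  then show "q' \<le> tm_states M" "length ms = tm_tapes M" "\<And>m. m \<in> set ms \<Longrightarrow> fst m < tm_symbols M"
    by auto
qed

lemma good_config_step:
  assumes "wf_tm M" "good_config M c"
  shows "good_config M (tm_step M c)"
proof (cases "fst c < tm_states M")
  case True
  obtain q ts where c: "c = (q, ts)" by fastforce
  obtain q' ms where d: "tm_delta M q (map tape_read ts) = (q', ms)" by fastforce
  note wf = wf_tm_delta[OF assms(1) assms(2)[unfolded c] _ d]
  have "\<forall>t \<in> set (map2 tape_act ms ts). \<forall>j. snd t j < tm_symbols M"
  proof
    fix t assume "t \<in> set (map2 tape_act ms ts)"
    then obtain m t' where m: "(m, t') \<in> set (zip ms ts)" "t = tape_act m t'" by auto
    then have "m \<in> set ms" "t' \<in> set ts" by (auto dest: set_zip_leftD set_zip_rightD)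
    with m show "\<forall>j. snd t j < tm_symbols M"
      using wf(3) True assms(2) by (auto simp: c good_config_def tape_act_conv)
  qed
  then show ?thesis
    using True wf assms(2) by (auto simp: good_config_def tm_step_def c d)
qed (use assms in \<open>auto simp: tm_step_def good_config_def split: prod.split\<close>)

lemma tm_reach:
  assumes "wf_tm M" "(tm_step M ^^ n) (tm_init M x) = (q, ts)"
  shows "good_config M (q, ts) \<and>
    (\<forall>t \<in> set ts. fst t \<le> int n \<and> (\<forall>j \<ge> int (length x + n). snd t j = 0))"
  using assms(2)
proof (induction n arbitrary: q ts)
  case 0
  then show ?case using good_config_init[OF assms(1), of x]
    by (auto simp: tm_init_def str_tape_def)
next
  case (Suc n)
  obtain p us where c: "(tm_step M ^^ n) (tm_init M x) = (p, us)" by fastforce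
  note IH = Suc.IH[OF c]
  have step: "(q, ts) = tm_step M (p, us)" using Suc.prems c by simp
  have good: "good_config M (q, ts)" unfolding step using IH good_config_step[OF assms(1)] by blast
  obtain p' ms where d: "tm_delta M p (map tape_read us) = (p', ms)" by fastforce
  have "fst t \<le> int (Suc n) \<and> (\<forall>j \<ge> int (length x + Suc n). snd t j = 0)" if "t \<in> set ts" for t
  proof (cases "p < tm_states M")
    case True
    then have "ts = map2 tape_act ms us" using step by (simp add: tm_step_def d)
    then obtain m u where m: "(m, u) \<in> set (zip ms us)" "t = tape_act m u" using \<open>t \<in> set ts\<close> by auto
    then have "u \<in> set us" by (auto dest: set_zip_rightD)
    moreover have "head_shift (snd m) \<le> 1" by (cases "snd m") auto
    ultimately show ?thesis using IH m(2) by (auto simp: tape_act_conv)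
  next
    case False
    then show ?thesis using IH step that by (auto simp: tm_step_def)
  qed
  with good show ?case by blast
qed

text \<open>The last cell of the output is not blank, and a head starting at cell 0 cannot have
  written that far to the right in fewer steps. This bounds the search through the output of
  \<open>f\<close> and, later, the number of index bits.\<close>

lemma length_output_le:
  assumes "wf_tm M" "tm_outputs_within M x y t"
  shows "length y \<le> length x + t"
proof (rule ccontr)
  assume *: "\<not> length y \<le> length x + t"
  obtain q ts where c: "(tm_step M ^^ t) (tm_init M x) = (q, ts)" by fastforce
  note r = tm_reach[OF assms(1) c]
  have "ts \<noteq> []" using r assms(1) by (auto simp: good_config_def wf_tm_def)
  then have "last ts \<in> set ts" by simp
  moreover have "last ts = str_tape y" using assms(2) c by (simp add: tm_outputs_within_def)
  moreover have "int (length x + t) \<le> int (length y - 1)" using * by linarith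
  ultimately have "snd (str_tape y) (int (length y - 1)) = 0"
    using r by auto
  then show False using * by (auto simp: str_tape_def split: if_splits)
qed

subsection \<open>Simulating a machine on a block of tapes\<close>

text \<open>Since the state is stored on a tape, the alphabet must also contain all states,
  including the halting one.\<close>

definition sim_symbols :: "tm \<Rightarrow> nat" where
  "sim_symbols M = 3 + tm_symbols M + tm_states M"

text \<open>The tapes of \<open>M\<close> are the tapes \<open>1\<close> to \<open>tm_tapes M\<close>, and the state is kept as a symbol on the next one.
  The cut-off by \<open>min\<close> only serves to keep the action well-formed on unreachable symbols.\<close>

definition sim_act :: "tm \<Rightarrow> (nat \<Rightarrow> nat) \<Rightarrow> action" where
  "sim_act M r = (case tm_delta M (r (Suc (tm_tapes M))) (map r [1..<Suc (tm_tapes M)]) of (q, ms) \<Rightarrow>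
     (\<lambda>i. if 1 \<le> i \<and> i \<le> tm_tapes M \<and> i - 1 < length ms
            then (min (fst (ms ! (i - 1))) (sim_symbols M - 1), snd (ms ! (i - 1)))
          else if i = Suc (tm_tapes M) then (min q (sim_symbols M - 1), MStay)
          else (r i, MStay)))"

definition sim :: "tm \<Rightarrow> prog" where
  "sim M = While (\<lambda>r. r (Suc (tm_tapes M)) < tm_states M) (Act (sim_act M))"

definition embed_config :: "tm \<Rightarrow> store \<Rightarrow> config \<Rightarrow> store" where
  "embed_config M \<sigma> c = (\<lambda>i. if 1 \<le> i \<and> i \<le> tm_tapes M then snd c ! (i - 1)
     else if i = Suc (tm_tapes M) then T [] [fst c] else \<sigma> i)"

lemma acts_sim_act:
  assumes "wf_tm M" "good_config M (q, ts)" "q < tm_states M"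
  shows "acts (sim_act M (rd (embed_config M \<sigma> (q, ts)))) (embed_config M \<sigma> (q, ts)) = embed_config M \<sigma> (tm_step M (q, ts))"
proof -
  obtain q' ms where d: "tm_delta M q (map tape_read ts) = (q', ms)" by fastforce
  note wf = wf_tm_delta[OF assms d]
  have len: "length ts = tm_tapes M" using assms(2) by (simp add: good_config_def)
  have rds: "map (rd (embed_config M \<sigma> (q, ts))) [1..<Suc (tm_tapes M)] = map tape_read ts"
    by (rule nth_equalityI) (auto simp: embed_config_def len simp del: upt_Suc)
  have q: "rd (embed_config M \<sigma> (q, ts)) (Suc (tm_tapes M)) = q" by (simp add: embed_config_def)
  have min: "min (fst (ms ! i)) (sim_symbols M - 1) = fst (ms ! i)" if "i < tm_tapes M" for i
    using wf(3)[of "ms ! i"] wf(2) that by (auto simp: sim_symbols_def)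
  have minq: "min q' (sim_symbols M - 1) = q'" using wf(1) by (auto simp: sim_symbols_def)
  have step: "tm_step M (q, ts) = (q', map2 tape_act ms ts)"
    using assms(3) d by (simp add: tm_step_def)
  have stay: "tape_act (tape_read t, MStay) t = t" for t :: tape by (cases t) auto
  show ?thesis
  proof
    fix i
    consider "1 \<le> i \<and> i \<le> tm_tapes M" | "i = Suc (tm_tapes M)" | "i = 0 \<or> i > Suc (tm_tapes M)" by linarith
    then show "acts (sim_act M (rd (embed_config M \<sigma> (q, ts)))) (embed_config M \<sigma> (q, ts)) i = embed_config M \<sigma> (tm_step M (q, ts)) i"
    proof cases
      case 1
      then have "i - 1 < tm_tapes M" by auto
      then show ?thesis
        using 1 wf(2) len min[of "i - 1"] unfolding acts_def sim_act_def q rds d step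
        by (simp add: embed_config_def)
    next
      case 2
      then show ?thesis using minq unfolding acts_def sim_act_def q rds d step
        by (simp add: embed_config_def)
    next
      case 3
      then show ?thesis unfolding acts_def sim_act_def q rds d step
        by (auto simp: embed_config_def stay)
    qed
  qed
qed

text \<open>The machine may have halted before step \<open>n\<close>. The simulation then leaves its
  loop early, in the configuration that persists until step \<open>n\<close>.\<close>

lemma runs_sim:
  assumes "wf_tm M" "good_config M c" "(tm_step M ^^ n) c = (tm_states M, ts)"
  shows "runs (sim M) (embed_config M \<sigma> c) (2 * n + 1) (embed_config M \<sigma> (tm_states M, ts))"
  using assms(2,3)
proof (induction n arbitrary: c)
  case 0
  then show ?case unfolding sim_def
    by (auto intro!: runs_While_false simp: embed_config_def)
next
  case (Suc n)
  obtain q us where c: "c = (q, us)" by fastforce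
  show ?case
  proof (cases "q < tm_states M")
    case True
    have "runs (Act (sim_act M)) (embed_config M \<sigma> c) 1 (embed_config M \<sigma> (tm_step M c))"
      unfolding c by (rule runs_Act, rule acts_sim_act[OF assms(1)]) (use Suc.prems c True in auto)
    moreover have "runs (sim M) (embed_config M \<sigma> (tm_step M c)) (2 * n + 1) (embed_config M \<sigma> (tm_states M, ts))"
      using Suc.IH[OF good_config_step[OF assms(1) Suc.prems(1)]] Suc.prems(2) by (simp add: funpow_swap1)
    ultimately show ?thesis unfolding sim_def
      by (rule runs_While_true[rotated]) (use True in \<open>auto simp: c embed_config_def\<close>)
  next
    case False
    then have q: "q = tm_states M" using Suc.prems(1) by (simp add: c good_config_def)
    then have "(tm_states M, us) = (tm_states M, ts)" using Suc.prems(2) tm_step_halted c by metis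
    then show ?thesis unfolding sim_def c q
      by (auto intro!: runs_While_false simp: embed_config_def)
  qed
qed

lemma wf_prog_sim:
  assumes "Suc (tm_tapes M) < k"
  shows "wf_prog k (sim_symbols M) (sim M)"
  using assms by (auto simp: sim_def wf_act_def sim_act_def sim_symbols_def split: prod.split)

subsection \<open>Unary powers\<close>

text \<open>\<open>j\<close> nested loops, each running once along its own copy of \<open>z\<close>;
  the innermost body writes one symbol, the code 2 of True. The nesting depth will be the constant
  \<open>K\<close>, so this is one fixed program for all inputs.\<close>

fun pow_prog :: "nat \<Rightarrow> nat \<Rightarrow> prog" where
  "pow_prog c 0 = one_act 1 (\<lambda>_. 2) MRight"
| "pow_prog c (Suc j) =
     While (\<lambda>r. r (c + j) \<noteq> 0) (pow_prog c j ;; one_act (c + j) id MRight) ;; rewind (c + j)"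

fun pow_time :: "nat \<Rightarrow> nat poly" where
  "pow_time 0 = [:1:]"
| "pow_time (Suc j) = [:0, 1:] * (pow_time j + [:2:]) + [:5, 2:]"

lemma runs_pow_prog:
  assumes "1 < c" "\<And>i. i < j \<Longrightarrow> \<sigma> (c + i) = T [] (encs z)" "\<sigma> 1 = T l []"
  shows "runs (pow_prog c j) \<sigma> (poly (pow_time j) (length z))
    (\<sigma>(1 := T (replicate (length z ^ j) 2 @ l) []))"
  using assms(2,3)
proof (induction j arbitrary: \<sigma> l)
  case 0
  show ?case unfolding pow_prog.simps by (rule runs_Act) (use 0 in auto)
next
  case (Suc j)
  let ?N = "length z"
  let ?P = "poly (pow_time j) ?N"
  \<comment> \<open>Stated for a tape already scanned up to \<open>x\<close>, so that induction on
    the rest \<open>y\<close> applies.\<close>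
  have loop: "runs (While (\<lambda>r. r (c + j) \<noteq> 0) (pow_prog c j ;; one_act (c + j) id MRight)) \<sigma>
     (length y * (?P + 2) + 1)
     (\<sigma>(1 := T (replicate (length y * ?N ^ j) 2 @ l) [], c + j := T (encs (rev y @ x)) []))"
    if "\<And>i. i < j \<Longrightarrow> \<sigma> (c + i) = T [] (encs z)" "\<sigma> 1 = T l []" "\<sigma> (c + j) = T (encs x) (encs y)" for x y \<sigma> l
    using that
  proof (induction y arbitrary: x \<sigma> l)
    case Nil
    have "\<sigma> = \<sigma>(1 := T l [], c + j := T (encs x) [])" using Nil by (auto simp: fun_eq_iff)
    then show ?case using Nil
      by (intro runs_cong[OF runs_While_false[OF _ order.refl]]) auto
  next
    case (Cons b y)
    let ?\<sigma>1 = "\<sigma>(1 := T (replicate (?N ^ j) 2 @ l) [])"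
    let ?\<sigma>2 = "\<sigma>(1 := T (replicate (?N ^ j) 2 @ l) [], c + j := T (encs (b # x)) (encs y))"
    have 1: "runs (pow_prog c j) \<sigma> ?P ?\<sigma>1"
      by (rule Suc.IH) (use Cons.prems in auto)
    have 2: "runs (one_act (c + j) id MRight) ?\<sigma>1 1 ?\<sigma>2"
      by (rule runs_Act) (use Cons.prems assms(1) in auto)
    have 3: "runs (While (\<lambda>r. r (c + j) \<noteq> 0) (pow_prog c j ;; one_act (c + j) id MRight)) ?\<sigma>2
     (length y * (?P + 2) + 1)
     (?\<sigma>2(1 := T (replicate (length y * ?N ^ j) 2 @ replicate (?N ^ j) 2 @ l) [],
        c + j := T (encs (rev y @ b # x)) []))"
      by (rule Cons.IH) (use Cons.prems assms(1) in auto)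
    have "?\<sigma>2(1 := T (replicate (length y * ?N ^ j) 2 @ replicate (?N ^ j) 2 @ l) [],
        c + j := T (encs (rev y @ b # x)) []) =
      \<sigma>(1 := T (replicate (length (b # y) * ?N ^ j) 2 @ l) [], c + j := T (encs (rev (b # y) @ x)) [])"
    proof -
      have rep: "replicate a 2 @ replicate b 2 @ l = replicate (b + a) 2 @ l" for a b :: nat and l :: "nat list"
        by (metis append_assoc replicate_add add.commute)
      show ?thesis by (auto simp: fun_eq_iff rep)
    qed
    then show ?case
      by (rule runs_cong[OF runs_While_true[OF _ runs.seq[OF 1 2] 3 order.refl], rotated 2])
        (use Cons.prems in auto)
  qed
  let ?\<tau> = "\<sigma>(1 := T (replicate (?N * ?N ^ j) 2 @ l) [], c + j := T (encs (rev z)) [])"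
  have 1: "runs (While (\<lambda>r. r (c + j) \<noteq> 0) (pow_prog c j ;; one_act (c + j) id MRight)) \<sigma>
     (?N * (?P + 2) + 1) ?\<tau>"
    by (rule runs_cong[OF loop[of \<sigma> l "[]" z]]) (use Suc.prems in auto)
  have 2: "runs (rewind (c + j)) ?\<tau> (2 * ?N + 4) (\<sigma>(1 := T (replicate (?N ^ Suc j) 2 @ l) []))"
    by (rule runs_cong[OF runs_rewind[OF _ _ order.refl]])
      (use Suc.prems(1)[of j] assms(1) in \<open>auto simp: fun_eq_iff\<close>)
  show ?case unfolding pow_prog.simps
    by (rule runs.weaken[OF runs.seq[OF 1 2]]) (auto simp: algebra_simps)
qed

fun copies :: "nat \<Rightarrow> nat \<Rightarrow> prog" where
  "copies c 0 = Act stay"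
| "copies c (Suc j) = copies c j ;; copy 0 (c + j) (\<lambda>x. x \<noteq> 0) id ;; rewind 0 ;; rewind (c + j)"

lemma runs_copies:
  assumes "0 < c" "\<sigma> 0 = T [] (encs z)" "\<And>i. i < j \<Longrightarrow> \<sigma> (c + i) = T [] []"
  shows "runs (copies c j) \<sigma> (1 + j * (6 * length z + 9))
    (\<lambda>i. if c \<le> i \<and> i < c + j then T [] (encs z) else \<sigma> i)"
  using assms(3)
proof (induction j)
  case 0
  show ?case unfolding copies.simps by (rule runs_Act) (auto simp: fun_eq_iff)
next
  case (Suc j)
  let ?\<sigma> = "\<lambda>i. if c \<le> i \<and> i < c + j then T [] (encs z) else \<sigma> i"
  let ?\<sigma>1 = "?\<sigma>(0 := T (encs (rev z)) [], c + j := T (encs (rev z)) [])"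
  have 1: "runs (copies c j) \<sigma> (1 + j * (6 * length z + 9)) ?\<sigma>"
    by (rule Suc.IH) (use Suc.prems in auto)
  have 2: "runs (copy 0 (c + j) (\<lambda>x. x \<noteq> 0) id) ?\<sigma> (2 * length z + 1) ?\<sigma>1"
    by (rule runs_cong[OF runs_copy[where xs = "encs z" and ys = "[]" and l = "[]" and m = "[]", OF _ _ _ _ _ order.refl]])
      (use assms Suc.prems[of j] in \<open>auto simp: encs_def rev_map\<close>)
  have 3: "runs (rewind 0) ?\<sigma>1 (2 * length z + 4) (?\<sigma>1(0 := T [] (encs z)))"
    by (rule runs_cong[OF runs_rewind[where l = "encs (rev z)" and r = "[]", OF _ _ order.refl]])
      (use assms in auto)
  have 4: "runs (rewind (c + j)) (?\<sigma>1(0 := T [] (encs z))) (2 * length z + 4)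
     (?\<sigma>1(0 := T [] (encs z), c + j := T [] (encs z)))"
    by (rule runs_cong[OF runs_rewind[where l = "encs (rev z)" and r = "[]", OF _ _ order.refl]])
      (use assms in auto)
  have "?\<sigma>1(0 := T [] (encs z), c + j := T [] (encs z)) =
     (\<lambda>i. if c \<le> i \<and> i < c + Suc j then T [] (encs z) else \<sigma> i)"
    using assms(1,2) by (auto simp: fun_eq_iff)
  then show ?case unfolding copies.simps
    by (rule runs_cong[OF runs.seq[OF 1 runs.seq[OF 2 runs.seq[OF 3 4]]], rotated]) simp
qed

subsection \<open>Indexing with a binary counter\<close>

text \<open>One decrement of the counter on tape 0, paired with one step along the tape
  \<open>out\<close>. If no one is found, the counter was zero and the head on \<open>out\<close>
  stands at the wanted position; raising the flag \<open>fl\<close> ends the search.\<close>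

definition dec_prog :: "nat \<Rightarrow> nat \<Rightarrow> prog" where
  "dec_prog out fl = scan 0 (\<lambda>x. x = 1) (\<lambda>_. 2) ;;
     Cond (\<lambda>r. r 0 = 2) (one_act 0 (\<lambda>_. 1) MStay ;; rewind 0 ;; one_act out id MRight)
       (one_act fl (\<lambda>_. 1) MStay)"

definition find_prog :: "nat \<Rightarrow> nat \<Rightarrow> prog" where
  "find_prog out fl = While (\<lambda>r. r fl = 0 \<and> r out \<noteq> 0) (dec_prog out fl)"

lemma val_replicate_append:
  "val (replicate n False @ y) = 2 ^ n * val y"
  "val (replicate n True @ y) + 1 = 2 ^ n * (val y + 1)"
  by (induction n) auto

lemma runs_dec_prog:
  assumes "\<sigma> 0 = T [] (encs z)" "\<sigma> out = T l (encs (b # ys))" "\<sigma> fl = T [] []" "0 < out" "0 < fl" "out \<noteq> fl"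
  shows "\<exists>z'. length z' = length z \<and>
    (if val z = 0 then runs (dec_prog out fl) \<sigma> (4 * length z + 9) (\<sigma>(0 := T (encs z') [], fl := T [] [1]))
     else val z = Suc (val z') \<and>
       runs (dec_prog out fl) \<sigma> (4 * length z + 9) (\<sigma>(0 := T [] (encs z'), out := T (enc b # l) (encs ys))))"
proof -
  define n where "n = length (takeWhile Not z)"
  define y where "y = dropWhile Not z"
  have "takeWhile Not z = replicate n False"
    unfolding n_def by (rule replicate_eqI) (auto dest: set_takeWhileD)
  then have z: "z = replicate n False @ y"
    using takeWhile_dropWhile_id[of Not z] by (simp add: y_def)
  have y: "y = [] \<or> (\<exists>y'. y = True # y')"
    unfolding y_def using hd_dropWhile[of Not z] by (cases "dropWhile Not z") auto
  let ?\<sigma>1 = "\<sigma>(0 := T (encs (replicate n True)) (encs y))"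
  have 1: "runs (scan 0 (\<lambda>x. x = 1) (\<lambda>_. 2)) \<sigma> (2 * n + 1) ?\<sigma>1"
    by (rule runs_cong[OF runs_scan[where xs = "replicate n 1" and ys = "encs y" and l = "[]", OF _ _ _ order.refl]])
      (use y assms in \<open>auto simp: z encs_def enc_def map_replicate\<close>)
  show ?thesis
  proof (cases y)
    case Nil
    have 2: "runs (one_act fl (\<lambda>_. 1) MStay) ?\<sigma>1 1 (?\<sigma>1(fl := T [] [1]))"
      by (rule runs_Act) (use assms in auto)
    have 3: "runs (Cond (\<lambda>r. r 0 = 2) (one_act 0 (\<lambda>_. 1) MStay ;; rewind 0 ;; one_act out id MRight)
       (one_act fl (\<lambda>_. 1) MStay)) ?\<sigma>1 2 (?\<sigma>1(fl := T [] [1]))"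
      by (rule runs_If_false[OF _ 2]) (use Nil in auto)
    have "runs (dec_prog out fl) \<sigma> (4 * length z + 9) (\<sigma>(0 := T (encs (replicate n True)) [], fl := T [] [1]))"
      unfolding dec_prog_def
      by (rule runs_cong[OF runs.seq[OF 1 3]]) (use Nil in \<open>auto simp: z\<close>)
    moreover have "val z = 0" "length z = n" using Nil val_replicate_append(1)[of n y] by (auto simp: z)
    ultimately show ?thesis by (intro exI[of _ "replicate n True"]) simp
  next
    case (Cons a y')
    with y have a: "y = True # y'" by auto
    let ?\<sigma>2 = "\<sigma>(0 := T (encs (replicate n True)) (encs (False # y')))"
    let ?z = "replicate n True @ False # y'"
    have 2: "runs (one_act 0 (\<lambda>_. 1) MStay) ?\<sigma>1 1 ?\<sigma>2"
      by (rule runs_Act) (auto simp: a enc_def)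
    have 3: "runs (rewind 0) ?\<sigma>2 (2 * n + 4) (\<sigma>(0 := T [] (encs ?z)))"
      by (rule runs_cong[OF runs_rewind[where l = "encs (replicate n True)" and r = "encs (False # y')", OF _ _ order.refl]])
        auto
    have 4: "runs (one_act out id MRight) (\<sigma>(0 := T [] (encs ?z))) 1
       (\<sigma>(0 := T [] (encs ?z), out := T (enc b # l) (encs ys)))"
      by (rule runs_Act) (use assms in auto)
    have 5: "runs (Cond (\<lambda>r. r 0 = 2) (one_act 0 (\<lambda>_. 1) MStay ;; rewind 0 ;; one_act out id MRight)
       (one_act fl (\<lambda>_. 1) MStay)) ?\<sigma>1 (2 * n + 7) (\<sigma>(0 := T [] (encs ?z), out := T (enc b # l) (encs ys)))"
      by (rule runs_If_true[OF _ runs.seq[OF 2 runs.seq[OF 3 4]]]) (auto simp: a)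
    have "runs (dec_prog out fl) \<sigma> (4 * length z + 9) (\<sigma>(0 := T [] (encs ?z), out := T (enc b # l) (encs ys)))"
      unfolding dec_prog_def
      by (rule runs_cong[OF runs.seq[OF 1 5]]) (auto simp: z)
    moreover have "val z = Suc (val ?z)" "length z = length ?z"
      using val_replicate_append(1)[of n y] val_replicate_append(2)[of n "False # y'"] by (auto simp: z a)
    ultimately show ?thesis by (intro exI[of _ ?z]) simp
  qed
qed

text \<open>The value of \<open>z\<close> may be exponential in its length, but the search also ends
  when the string is exhausted, so the number of rounds is bounded by \<open>length ys\<close>. In
  that case the head reads a blank, which counts as the answer no.\<close>

lemma runs_find_prog:
  assumes "\<sigma> 0 = T [] (encs z)" "\<sigma> out = T l (encs ys)" "\<sigma> fl = T [] []" "0 < out" "0 < fl" "out \<noteq> fl"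
  shows "\<exists>\<tau>. runs (find_prog out fl) \<sigma> (length ys * (4 * length z + 10) + 2) \<tau> \<and>
    (\<forall>i. i \<noteq> 0 \<and> i \<noteq> out \<and> i \<noteq> fl \<longrightarrow> \<tau> i = \<sigma> i) \<and>
    (tape_read (\<tau> out) = 2 \<longleftrightarrow> val z < length ys \<and> ys ! val z)"
  using assms
proof (induction ys arbitrary: \<sigma> z l)
  case Nil
  have "runs (find_prog out fl) \<sigma> 2 \<sigma>"
    unfolding find_prog_def by (rule runs_While_false) (use Nil in auto)
  then show ?case using Nil by (intro exI[of _ \<sigma>]) (auto simp: numeral_2_eq_2)
next
  case (Cons b ys)
  from runs_dec_prog[OF Cons.prems] obtain z' where z': "length z' = length z"
    "if val z = 0 then runs (dec_prog out fl) \<sigma> (4 * length z + 9) (\<sigma>(0 := T (encs z') [], fl := T [] [1]))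
     else val z = Suc (val z') \<and>
       runs (dec_prog out fl) \<sigma> (4 * length z + 9) (\<sigma>(0 := T [] (encs z'), out := T (enc b # l) (encs ys)))"
    by blast
  show ?case
  proof (cases "val z = 0")
    case True
    let ?\<tau> = "\<sigma>(0 := T (encs z') [], fl := T [] [1])"
    have 1: "runs (dec_prog out fl) \<sigma> (4 * length z + 9) ?\<tau>" using z' True by simp
    have 2: "runs (find_prog out fl) ?\<tau> 1 ?\<tau>"
      unfolding find_prog_def by (rule runs_While_false) auto
    have "runs (find_prog out fl) \<sigma> (length (b # ys) * (4 * length z + 10) + 2) ?\<tau>"
      unfolding find_prog_def
      by (rule runs_While_true[OF _ 1 2[unfolded find_prog_def]]) (use Cons.prems in auto)
    moreover have "\<forall>i. i \<noteq> 0 \<and> i \<noteq> out \<and> i \<noteq> fl \<longrightarrow> ?\<tau> i = \<sigma> i"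
      "tape_read (?\<tau> out) = 2 \<longleftrightarrow> val z < length (b # ys) \<and> (b # ys) ! val z"
      using True Cons.prems by auto
    ultimately show ?thesis by blast
  next
    case False
    let ?\<sigma>' = "\<sigma>(0 := T [] (encs z'), out := T (enc b # l) (encs ys))"
    have 1: "runs (dec_prog out fl) \<sigma> (4 * length z + 9) ?\<sigma>'" and v: "val z = Suc (val z')"
      using z' False by auto
    have "?\<sigma>' 0 = T [] (encs z')" "?\<sigma>' out = T (enc b # l) (encs ys)" "?\<sigma>' fl = T [] []"
      using Cons.prems by auto
    from Cons.IH[OF this Cons.prems(4-6)]
    obtain \<tau> where \<tau>: "runs (find_prog out fl) ?\<sigma>' (length ys * (4 * length z' + 10) + 2) \<tau>"
      "\<forall>i. i \<noteq> 0 \<and> i \<noteq> out \<and> i \<noteq> fl \<longrightarrow> \<tau> i = ?\<sigma>' i"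
      "tape_read (\<tau> out) = 2 \<longleftrightarrow> val z' < length ys \<and> ys ! val z'"
      by blast
    have "runs (find_prog out fl) \<sigma> (length (b # ys) * (4 * length z + 10) + 2) \<tau>"
      unfolding find_prog_def
      by (rule runs_While_true[OF _ 1 \<tau>(1)[unfolded find_prog_def]]) (use Cons.prems z'(1) in auto)
    then show ?thesis using v \<tau>(2,3) by (intro exI[of _ \<tau>]) auto
  qed
qed

text \<open>Tape 0 holds \<open>z\<close>, tapes 1 to \<open>k\<close> belong to \<open>M\<close>,
  with its output on tape \<open>k\<close>. Then come its state on \<open>k + 1\<close>, the flag on
  \<open>k + 2\<close>, the \<open>K\<close> copies of \<open>z\<close>, and last the
  answer.\<close>

definition lookup_prog :: "tm \<Rightarrow> nat \<Rightarrow> prog" where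
  "lookup_prog M K = (let k = tm_tapes M in
     copies (k + 3) K ;; pow_prog (k + 3) K ;; rewind 1 ;; sim M ;; find_prog k (k + 2) ;;
     Act (\<lambda>r. (stay r)(k + 3 + K := (if r k = 2 then 2 else 1, MStay))))"

lemma wf_lookup_prog:
  assumes "wf_tm M"
  shows "wf_prog (tm_tapes M + 4 + K) (sim_symbols M) (lookup_prog M K)"
proof -
  have S: "3 \<le> sim_symbols M" by (simp add: sim_symbols_def)
  have k: "1 \<le> tm_tapes M" using assms by (simp add: wf_tm_def)
  have "wf_prog k S (copies c j)" if "c + j \<le> k" "0 < k" for k S c j
    using that by (induction j) (auto intro!: wf_prog_tape_ops wf_act_stay)
  moreover have "wf_prog k S (pow_prog c j)" if "c + j \<le> k" "1 < k" "3 \<le> S" for k S c j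
    using that by (induction j) (auto intro!: wf_prog_tape_ops wf_act_stay_upd wf_act_stay)
  ultimately show ?thesis
    using S k
    by (auto simp: lookup_prog_def Let_def find_prog_def dec_prog_def
        intro!: wf_prog_tape_ops wf_act_stay_upd wf_act_stay wf_prog_sim)
qed

lemma class_P_lookup_lang:
  assumes "polytime_computable f"
  shows "lookup_lang f K \<in> class_P"
proof -
  obtain M and p :: "nat poly" where wf: "wf_tm M"
    and f: "\<And>x. tm_outputs_within M x (f x) (poly p (length x))"
    using assms unfolding polytime_computable_def by blast
  define k where "k = tm_tapes M"
  have k: "1 \<le> k" using wf by (simp add: wf_tm_def k_def)
  \<comment> \<open>The running time of \<open>M\<close> on the unary input of length
    \<open>N ^ K\<close>, as a polynomial in \<open>N\<close>.\<close>
  define e where "e = pcompose p ([:0, 1:] ^ K)"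
  define q where "q = [:1 + K * 9, K * 6:] + (pow_time K + ((smult 2 ([:0, 1:] ^ K) + [:4:]) + ((smult 2 e + [:1:]) +
      ((([:0, 1:] ^ K + e) * [:10, 4:] + [:2:]) + [:1:]))))"
  have "\<exists>\<tau>. runs (lookup_prog M K) (init_store z) (poly q (length z)) \<tau> \<and>
     \<tau> (k + 4 + K - 1) = str_tape [z \<in> lookup_lang f K]" for z
  proof -
    let ?N = "length z" and ?c = "k + 3"
    define x where "x = replicate (?N ^ K) True"
    let ?t = "poly p (length x)"
    have e: "poly e ?N = ?t" by (simp add: e_def x_def poly_pcompose poly_power)
    define \<sigma>1 where "\<sigma>1 = (\<lambda>i. if ?c \<le> i \<and> i < ?c + K then T [] (encs z) else init_store z i)"
    have 1: "runs (copies ?c K) (init_store z) (1 + K * (6 * ?N + 9)) \<sigma>1"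
      unfolding \<sigma>1_def by (rule runs_copies) (auto simp: init_store_def str_tape_conv)
    let ?\<sigma>2 = "\<sigma>1(1 := T (replicate (?N ^ K) 2 @ []) [])"
    have 2: "runs (pow_prog ?c K) \<sigma>1 (poly (pow_time K) ?N) ?\<sigma>2"
      by (rule runs_pow_prog) (use k in \<open>auto simp: \<sigma>1_def init_store_def str_tape_conv\<close>)
    let ?\<sigma>3 = "embed_config M \<sigma>1 (tm_init M x)"
    \<comment> \<open>No initialisation of the simulation is needed: the blank on the state tape
      already codes the start state 0.\<close>
    have "\<sigma>1(1 := str_tape x) = ?\<sigma>3"
    proof
      fix i
      show "(\<sigma>1(1 := str_tape x)) i = ?\<sigma>3 i"
        using k by (auto simp: embed_config_def tm_init_def \<sigma>1_def init_store_def nth_Cons k_def[symmetric]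
            str_tape_conv split: nat.split)
    qed
    moreover have "str_tape x = T [] (replicate (?N ^ K) 2)"
      by (simp add: str_tape_conv x_def encs_def enc_def)
    ultimately have 3: "runs (rewind 1) ?\<sigma>2 (2 * ?N ^ K + 4) ?\<sigma>3"
      by (intro runs_cong[OF runs_rewind[where l = "replicate (?N ^ K) 2" and r = "[]", OF _ _ order.refl]]) auto
    obtain ts where ts: "(tm_step M ^^ ?t) (tm_init M x) = (tm_states M, ts)" "last ts = str_tape (f x)"
      using f[of x] by (auto simp: tm_outputs_within_def split: prod.splits)
    let ?\<sigma>4 = "embed_config M \<sigma>1 (tm_states M, ts)"
    have 4: "runs (sim M) ?\<sigma>3 (2 * ?t + 1) ?\<sigma>4"
      by (rule runs_sim[OF wf good_config_init[OF wf] ts(1)])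
    have "length ts = k" using tm_reach[OF wf ts(1)] by (simp add: good_config_def k_def)
    then have out: "?\<sigma>4 k = T [] (encs (f x))"
      using k ts(2) last_conv_nth[of ts] by (cases ts) (auto simp: embed_config_def k_def[symmetric] str_tape_conv)
    have "\<exists>\<tau>. runs (find_prog k (k + 2)) ?\<sigma>4 (length (f x) * (4 * length z + 10) + 2) \<tau> \<and>
      (\<forall>i. i \<noteq> 0 \<and> i \<noteq> k \<and> i \<noteq> k + 2 \<longrightarrow> \<tau> i = ?\<sigma>4 i) \<and>
      (tape_read (\<tau> k) = 2 \<longleftrightarrow> val z < length (f x) \<and> f x ! val z)"
      by (rule runs_find_prog[where \<sigma> = ?\<sigma>4, OF _ out])
        (use k in \<open>auto simp: embed_config_def \<sigma>1_def init_store_def str_tape_conv k_def[symmetric]\<close>)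
    then obtain \<tau> where 5: "runs (find_prog k (k + 2)) ?\<sigma>4 (length (f x) * (4 * length z + 10) + 2) \<tau>"
      and \<tau>: "\<And>i. i \<noteq> 0 \<and> i \<noteq> k \<and> i \<noteq> k + 2 \<Longrightarrow> \<tau> i = ?\<sigma>4 i"
      and res: "tape_read (\<tau> k) = 2 \<longleftrightarrow> z \<in> lookup_lang f K"
      by (auto simp: lookup_lang_def x_def)
    have ans: "\<tau> (k + 3 + K) = T [] []"
      using \<tau>[of "k + 3 + K"] k
      by (auto simp: embed_config_def \<sigma>1_def init_store_def str_tape_conv k_def[symmetric])
    let ?\<tau> = "\<tau>(k + 3 + K := T [] [enc (z \<in> lookup_lang f K)])"
    have 6: "runs (Act (\<lambda>r. (stay r)(k + 3 + K := (if r k = 2 then 2 else 1, MStay)))) \<tau> 1 ?\<tau>"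
      by (rule runs_Act) (use ans res in \<open>auto simp: enc_def\<close>)
    have len: "length (f x) \<le> ?N ^ K + ?t"
      using length_output_le[OF wf f[of x]] by (simp add: x_def)
    have "runs (lookup_prog M K) (init_store z) (poly q ?N) ?\<tau>"
      unfolding lookup_prog_def Let_def k_def[symmetric]
    proof (rule runs.weaken[OF runs.seq[OF 1 runs.seq[OF 2 runs.seq[OF 3 runs.seq[OF 4 runs.seq[OF 5 6]]]]]])
      have "length (f x) * (4 * ?N + 10) \<le> (?N ^ K + ?t) * (4 * ?N + 10)"
        by (rule mult_right_mono[OF len]) simp
      moreover have "poly q ?N = 1 + K * (6 * ?N + 9) + (poly (pow_time K) ?N + (2 * ?N ^ K + 4 +
          (2 * ?t + 1 + ((?N ^ K + ?t) * (4 * ?N + 10) + 2 + 1))))"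
        by (simp add: q_def e poly_power algebra_simps)
      ultimately show "1 + K * (6 * ?N + 9) + (poly (pow_time K) ?N + (2 * ?N ^ K + 4 +
          (2 * ?t + 1 + (length (f x) * (4 * ?N + 10) + 2 + 1)))) \<le> poly q ?N"
        by linarith
    qed
    moreover have "?\<tau> (k + 4 + K - 1) = str_tape [z \<in> lookup_lang f K]"
      by (simp add: str_tape_conv)
    ultimately show ?thesis by blast
  qed
  then obtain \<tau> where "\<And>z. runs (lookup_prog M K) (init_store z) (poly q (length z)) (\<tau> z)"
    "\<And>z. \<tau> z (k + 4 + K - 1) = str_tape [z \<in> lookup_lang f K]" by metis
  moreover have "wf_prog (k + 4 + K) (sim_symbols M) (lookup_prog M K)"
    unfolding k_def by (rule wf_lookup_prog[OF wf])
  ultimately have "polytime_computable (\<lambda>z. [z \<in> lookup_lang f K])"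
    by (intro polytime_computable_if_runs[where \<tau> = \<tau>]) (auto simp: sim_symbols_def)
  then show ?thesis by (simp add: class_P_def)
qed


section \<open>Circuits as NOR programs\<close>

definition nor_gate :: "nat set \<Rightarrow> bool list \<Rightarrow> bool" where
  "nor_gate R vs \<longleftrightarrow> \<not> (\<exists>i < length vs. i \<in> R \<and> vs ! i)"

definition nor_run :: "bool list \<Rightarrow> nat set list \<Rightarrow> bool list" where
  "nor_run = foldl (\<lambda>vs R. vs @ [nor_gate R vs])"

fun masks :: "nat \<Rightarrow> nat set list \<Rightarrow> bool list" where
  "masks n [] = []"
| "masks n (R # Rs) = map (\<lambda>i. i \<in> R) [0..<n] @ masks (Suc n) Rs"

lemma nor_run_simps [simp]:
  "nor_run vs [] = vs" "nor_run vs (R # Rs) = nor_run (vs @ [nor_gate R vs]) Rs"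
  by (auto simp: nor_run_def)

lemma nor_run_append: "nor_run vs (Rs @ Qs) = nor_run (nor_run vs Rs) Qs"
  by (simp add: nor_run_def)

lemma length_nor_run [simp]: "length (nor_run vs Rs) = length vs + length Rs"
  by (induction Rs arbitrary: vs) auto

lemma nor_run_nth: "i < length vs \<Longrightarrow> nor_run vs Rs ! i = vs ! i"
  by (induction Rs arbitrary: vs) (auto simp: nth_append)

text \<open>Each mask has at most \<open>n + length Rs\<close> bits. With \<open>O(N ^ d)\<close>
  gates this gives the \<open>N ^ (2 * d)\<close> that \<open>K\<close> has to beat.\<close>

lemma length_masks: "length (masks n Rs) \<le> length Rs * (n + length Rs)"
proof (induction Rs arbitrary: n)
  case (Cons R Rs)
  show ?case using Cons[of "Suc n"] by simp
qed simp

lemma nor_eval_block: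
  "length ms = length r \<Longrightarrow>
    nor_eval (ms @ ns) l r b = nor_eval ns (rev r @ l) [] (b \<or> (\<exists>i < length r. ms ! i \<and> r ! i))"
proof (induction ms arbitrary: l r b)
  case (Cons m ms)
  then obtain v r' where r: "r = v # r'" by (cases r) auto
  have "(\<exists>i < Suc (length r'). (m # ms) ! i \<and> (v # r') ! i) \<longleftrightarrow>
     m \<and> v \<or> (\<exists>i < length r'. ms ! i \<and> r' ! i)"
    by (auto simp: less_Suc_eq_0_disj)
  then show ?case using Cons.IH[of r' "v # l"] Cons.prems by (simp add: r disj_assoc)
qed simp

text \<open>The value of a gate becomes a wire only when the next mask begins; after the last mask
  it is returned instead. Either way it is the entry that \<open>nor_run\<close> appends.\<close>

lemma nor_eval_masks:
  assumes "vs \<noteq> []" "Rs \<noteq> []"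
  shows "nor_eval (masks (length vs) Rs) [] vs False = last (nor_run vs Rs)"
  using assms
proof (induction Rs arbitrary: vs)
  case (Cons R Rs)
  have gate: "nor_gate R vs = (\<not> (\<exists>i < length vs. map (\<lambda>i. i \<in> R) [0..<length vs] ! i \<and> vs ! i))"
    by (auto simp: nor_gate_def)
  have step: "nor_eval (masks (length vs) (R # Rs)) [] vs False
     = nor_eval (masks (Suc (length vs)) Rs) (rev vs) [] (\<not> nor_gate R vs)"
    unfolding masks.simps gate
    by (subst nor_eval_block) (simp, simp only: simp_thms append_Nil2)
  show ?case
  proof (cases Rs)
    case Nil
    then show ?thesis using step by simp
  next
    case (Cons Q Qs)
    \<comment> \<open>The next mask has \<open>Suc (length vs)\<close> bits, so the remaining list
      is not empty and the evaluation wraps around.\<close>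
    then obtain m ms where m: "masks (Suc (length vs)) Rs = m # ms"
      by (cases "masks (Suc (length vs)) Rs") auto
    have "nor_eval (m # ms) (rev vs) [] (\<not> nor_gate R vs) = nor_eval (m # ms) [] (vs @ [nor_gate R vs]) False"
      by simp
    then show ?thesis using step Cons.IH[of "vs @ [nor_gate R vs]"] m Cons by simp
  qed
qed simp

text \<open>The map \<open>\<phi>\<close> sends wires of the circuit to wires of the NOR program.
  The empty NOR is True, a NOR of one wire is negation, conjunction is the NOR of two negations (De
  Morgan), and disjunction a negated NOR; \<open>N\<close> and \<open>Suc N\<close> are the
  auxiliary wires just created.\<close>

lemma gate_as_nor:
  assumes "\<And>w. w \<in> gate_wires g \<Longrightarrow> \<phi> w < N"
  shows "\<exists>Rs. Rs \<noteq> [] \<and> length Rs \<le> 3 \<and> (\<forall>us vs. length vs = N \<longrightarrow>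
     (\<forall>w \<in> gate_wires g. us ! w = vs ! \<phi> w) \<longrightarrow> last (nor_run vs Rs) = gate_val us g)"
proof (cases g)
  case (GConst b)
  show ?thesis
  proof (cases b)
    case True
    then show ?thesis using GConst by (intro exI[of _ "[{}]"]) (auto simp: nor_gate_def)
  next
    case False
    then show ?thesis using GConst by (intro exI[of _ "[{}, {N}]"]) (auto simp: nor_gate_def nth_append)
  qed
next
  case (GNot i)
  then show ?thesis using assms by (intro exI[of _ "[{\<phi> i}]"]) (auto simp: nor_gate_def)
next
  case (GAnd i j)
  then show ?thesis using assms
    by (intro exI[of _ "[{\<phi> i}, {\<phi> j}, {N, Suc N}]"])
      (auto simp: nor_gate_def nth_append less_Suc_eq)
next
  case (GOr i j)
  then show ?thesis using assms
    by (intro exI[of _ "[{\<phi> i, \<phi> j}, {N}]"]) (auto simp: nor_gate_def nth_append less_Suc_eq)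
qed

definition circuit_run :: "str \<Rightarrow> circuit \<Rightarrow> bool list" where
  "circuit_run = foldl (\<lambda>vs g. vs @ [gate_val vs g])"

lemma circuit_run_simps [simp]:
  "circuit_run x [] = x" "circuit_run x (C @ [g]) = circuit_run x C @ [gate_val (circuit_run x C) g]"
  by (auto simp: circuit_run_def)

lemma length_circuit_run [simp]: "length (circuit_run x C) = length x + length C"
  by (induction C rule: rev_induct) auto

text \<open>A circuit gate becomes up to three NOR gates, so wire numbers shift irregularly and
  \<open>\<phi>\<close> keeps track of them. The clause with \<open>Suc\<close> says that the output
  gate ends up last, where \<open>nor_eval\<close> takes its result.\<close>

lemma circuit_as_nor_aux:
  assumes "\<forall>j < length C. gate_wires (C ! j) \<subseteq> {..<n + j}"
  shows "\<exists>Rs \<phi>. length Rs \<le> 3 * length C \<and> (\<forall>i < n + length C. \<phi> i < n + length Rs) \<and>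
    (C \<noteq> [] \<longrightarrow> Rs \<noteq> [] \<and> Suc (\<phi> (n + length C - 1)) = n + length Rs) \<and>
    (\<forall>x. length x = n \<longrightarrow> (\<forall>i < n + length C. circuit_run x C ! i = nor_run x Rs ! \<phi> i))"
  using assms
proof (induction C rule: rev_induct)
  case Nil
  show ?case by (intro exI[of _ "[]"] exI[of _ id]) auto
next
  case (snoc g C)
  have "\<forall>j < length C. gate_wires (C ! j) \<subseteq> {..<n + j}"
    using snoc.prems by (metis length_append_singleton less_SucI nth_append)
  from snoc.IH[OF this] obtain Rs \<phi> where IH: "length Rs \<le> 3 * length C"
    "\<And>i. i < n + length C \<Longrightarrow> \<phi> i < n + length Rs"
    "\<And>x i. length x = n \<Longrightarrow> i < n + length C \<Longrightarrow> circuit_run x C ! i = nor_run x Rs ! \<phi> i"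
    by blast
  have g: "gate_wires g \<subseteq> {..<n + length C}" using snoc.prems by (metis length_append_singleton lessI nth_append_length)
  then have "w \<in> gate_wires g \<Longrightarrow> \<phi> w < n + length Rs" for w using IH(2) by auto
  from gate_as_nor[of g \<phi>, OF this] obtain Qs where Qs: "Qs \<noteq> []" "length Qs \<le> 3"
    "\<And>us vs. length vs = n + length Rs \<Longrightarrow> (\<forall>w \<in> gate_wires g. us ! w = vs ! \<phi> w) \<Longrightarrow>
       last (nor_run vs Qs) = gate_val us g" by blast
  let ?\<phi> = "\<phi>(n + length C := n + length (Rs @ Qs) - 1)"
  have run: "circuit_run x (C @ [g]) ! i = nor_run x (Rs @ Qs) ! ?\<phi> i"
    if x: "length x = n" and i: "i < n + length (C @ [g])" for x i
  proof (cases "i = n + length C")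
    case True
    have "gate_val (circuit_run x C) g = last (nor_run (nor_run x Rs) Qs)"
      by (rule Qs(3)[symmetric]) (use x IH(3) g in auto)
    moreover have "nor_run (nor_run x Rs) Qs \<noteq> []" using Qs(1) by (metis add_is_0 length_0_conv length_nor_run)
    ultimately show ?thesis using True x by (simp add: nth_append nor_run_append last_conv_nth add.assoc)
  next
    case False
    then have "i < n + length C" using i by simp
    then show ?thesis using False x IH(2,3) by (simp add: nth_append nor_run_append nor_run_nth)
  qed
  show ?case
  proof (intro exI[of _ "Rs @ Qs"] exI[of _ ?\<phi>] conjI allI impI)
    fix i assume "i < n + length (C @ [g])"
    then show "?\<phi> i < n + length (Rs @ Qs)"
      using IH(2)[of i] Qs(1) by (auto simp: trans_less_add1)
  qed (use IH(1) Qs run in auto)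
qed

lemma circuit_as_masks:
  assumes "wf_circuit n C" "0 < n"
  shows "\<exists>ms. length ms \<le> 3 * length C * (n + 3 * length C) \<and>
    (\<forall>x. length x = n \<longrightarrow> nor_eval ms [] x False = circuit_eval C x)"
proof -
  have C: "C \<noteq> []" "\<forall>j < length C. gate_wires (C ! j) \<subseteq> {..<n + j}"
    using assms by (auto simp: wf_circuit_def)
  from circuit_as_nor_aux[OF C(2)] C(1) obtain Rs \<phi> where Rs: "length Rs \<le> 3 * length C" "Rs \<noteq> []"
    "Suc (\<phi> (n + length C - 1)) = n + length Rs"
    "\<And>x i. length x = n \<Longrightarrow> i < n + length C \<Longrightarrow> circuit_run x C ! i = nor_run x Rs ! \<phi> i"
    by blast
  have "nor_eval (masks n Rs) [] x False = circuit_eval C x" if x: "length x = n" for x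
  proof -
    have ne: "circuit_run x C \<noteq> []" "nor_run x Rs \<noteq> []"
      using x assms(2) by (auto dest!: arg_cong[where f = length])
    have "circuit_eval C x = last (circuit_run x C)" by (simp add: circuit_eval_def circuit_run_def)
    also have "\<dots> = circuit_run x C ! (n + length C - 1)"
      using ne(1) x by (simp add: last_conv_nth)
    also have "\<dots> = nor_run x Rs ! \<phi> (n + length C - 1)"
      using Rs(4) x assms(2) by simp
    also have "\<phi> (n + length C - 1) = n + length Rs - 1" using Rs(3) by simp
    also have "nor_run x Rs ! (n + length Rs - 1) = last (nor_run x Rs)"
      using ne(2) x by (simp add: last_conv_nth)
    also have "\<dots> = nor_eval (masks n Rs) [] x False"
      using nor_eval_masks[of x Rs] x assms(2) Rs(2) by auto
    finally show ?thesis by simp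
  qed
  moreover have "length (masks n Rs) \<le> 3 * length C * (n + 3 * length C)"
    by (rule order.trans[OF length_masks mult_mono]) (use Rs(1) in auto)
  ultimately show ?thesis by blast
qed

section \<open>The range of the generator\<close>

lemma val_inc: "Suc (val z) < 2 ^ length z \<Longrightarrow> val (inc z) = Suc (val z)"
  by (induction z rule: inc.induct) auto

lemma counter_val: "j < 2 ^ N \<Longrightarrow> length (counter N j) = N \<and> val (counter N j) = j"
proof (induction j)
  case 0
  show ?case using val_replicate_append(1)[of N "[]"] by (simp add: counter_def)
next
  case (Suc j)
  then show ?case using val_inc[of "counter N j"] by (auto simp: counter_def)
qed

section \<open>String lengths and the choice of parameters\<close>

lemma nat_of_str_snoc: "nat_of_str (w @ [b]) = 2 * nat_of_str w + (if b then 2 else 1)"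
  by (simp add: nat_of_str_def)

lemma nat_of_str_bounds: "2 ^ length w \<le> nat_of_str w + 1" "nat_of_str w + 2 \<le> 2 ^ (length w + 1)"
proof (induction w rule: rev_induct)
  case Nil
  show "2 ^ length [] \<le> nat_of_str [] + 1" "nat_of_str [] + 2 \<le> 2 ^ (length [] + 1)"
    by (auto simp: nat_of_str_def)
next
  case (snoc b w)
  show "2 ^ length (w @ [b]) \<le> nat_of_str (w @ [b]) + 1" "nat_of_str (w @ [b]) + 2 \<le> 2 ^ (length (w @ [b]) + 1)"
    using snoc by (auto simp: nat_of_str_snoc)
qed

text \<open>The order is length-lexicographic. This turns \<open>f x > x\<close> into a lower bound
  on length: on a string of length \<open>N ^ K\<close>, \<open>f\<close> yields at least
  \<open>N ^ K\<close> bits.\<close>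

lemma length_mono_nat_of_str:
  assumes "nat_of_str v < nat_of_str w"
  shows "length v \<le> length w"
proof -
  have "(2::nat) ^ length v < 2 ^ (length w + 1)"
    using nat_of_str_bounds(1)[of v] nat_of_str_bounds(2)[of w] assms by linarith
  then have "length v < length w + 1" by (rule power_less_imp_less_exp[rotated]) simp
  then show ?thesis by simp
qed

lemma output_in_range_gen:
  assumes C: "wf_circuit N C" "\<And>z. length z = N \<Longrightarrow> circuit_eval C z \<longleftrightarrow> z \<in> lookup_lang f K"
    and y: "y = f (replicate (N ^ K) True)" "length y \<le> 2 ^ N"
    and N: "0 < N" "N + 2 + 3 * length C * (N + 3 * length C) \<le> length y"
  shows "y \<in> range gen"
proof -
  from circuit_as_masks[OF C(1) N(1)] obtain ms where
    ms: "length ms \<le> 3 * length C * (N + 3 * length C)"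
      "\<And>x. length x = N \<Longrightarrow> nor_eval ms [] x False = circuit_eval C x" by blast
  \<comment> \<open>The 2 accounts for the separator and for the one bit by which the generator
    stretches.\<close>
  define u where "u = replicate (length y - (N + 2 + length ms)) False @ replicate N True @ False # ms"
  have len: "Suc (length u) = length y" using ms(1) N(2) by (simp add: u_def)
  obtain N' where N': "N = Suc N'" using N(1) by (cases N) auto
  have drop: "dropWhile Not u = replicate N True @ False # ms"
    unfolding u_def by (simp add: N' dropWhile_append3)
  have ar: "arity_of u = N"
    unfolding arity_of_def drop by (simp add: takeWhile_append)
  have ma: "masks_of u = ms"
    unfolding masks_of_def drop by (simp add: dropWhile_append)
  have "gen u = y"
  proof (rule nth_equalityI)
    show "length (gen u) = length y" using len by (simp add: gen_def)
    fix j assume "j < length (gen u)"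
    then have j: "j < length y" using len by (simp add: gen_def)
    then have c: "length (counter N j) = N" "val (counter N j) = j"
      using counter_val[of j N] y(2) by auto
    have "gen u ! j = nor_eval ms [] (counter N j) False"
      using j len by (simp add: gen_def ar ma del: upt_Suc)
    also have "\<dots> \<longleftrightarrow> counter N j \<in> lookup_lang f K" using ms(2) C(2) c(1) by simp
    also have "\<dots> \<longleftrightarrow> y ! j" using j c by (simp add: lookup_lang_def y(1))
    finally show "gen u ! j = y ! j" .
  qed
  then show ?thesis by blast
qed

text \<open>Ensures that \<open>N\<close> index bits reach every position of a string of length
  polynomial in \<open>N\<close>.\<close>

lemma eventually_poly_le_power2: "eventually (\<lambda>n. poly (p :: nat poly) n \<le> 2 ^ n) sequentially"
proof -
  have *: "poly p n \<le> poly p 1 * n ^ degree p" if "1 \<le> n" for n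
  proof -
    have "poly p n = (\<Sum>i\<le>degree p. coeff p i * n ^ i)" by (simp add: poly_altdef)
    also have "\<dots> \<le> (\<Sum>i\<le>degree p. coeff p i * n ^ degree p)"
      using that by (intro sum_mono mult_left_mono power_increasing) auto
    also have "\<dots> = poly p 1 * n ^ degree p"
      by (simp add: poly_altdef sum_distrib_right)
    finally show ?thesis .
  qed
  define c where "c = real (poly p 1)"
  define k where "k = degree p"
  have "eventually (\<lambda>n. c * real n ^ k \<le> 2 ^ n) sequentially"
  proof -
    \<comment> \<open>The limit of \<open>x ^ k / exp x\<close> is taken along
      \<open>x = n * ln 2\<close>, where \<open>exp x\<close> is \<open>2 ^ n\<close>. The
      denominator \<open>c + 1\<close> below stays positive for the zero polynomial.\<close>
    have "((\<lambda>n. (real n * ln 2) ^ k / exp (real n * ln 2)) \<longlongrightarrow> 0) sequentially"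
    proof (rule filterlim_compose[OF tendsto_power_div_exp_0])
      show "filterlim (\<lambda>n. real n * ln 2) at_top sequentially"
        by (rule filterlim_at_top_mult_tendsto_pos[OF tendsto_const _ filterlim_real_sequentially]) simp
    qed
    moreover have "0 < ln 2 ^ k / (c + 1)" by (simp add: c_def add_nonneg_pos)
    ultimately have "eventually (\<lambda>n. (real n * ln 2) ^ k / exp (real n * ln 2) < ln 2 ^ k / (c + 1)) sequentially"
      by (rule order_tendstoD(2))
    then show ?thesis
    proof eventually_elim
      case (elim n)
      have "exp (real n * ln 2) = 2 ^ n" by (simp add: exp_of_nat_mult)
      with elim have "real n ^ k * ln 2 ^ k / 2 ^ n < ln 2 ^ k / (c + 1)" by (simp add: power_mult_distrib)
      moreover have c: "0 < c + 1" by (simp add: c_def add_nonneg_pos)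
      ultimately have "real n ^ k / 2 ^ n < 1 / (c + 1)"
        by (simp add: divide_simps split: if_splits)
      with c have "(c + 1) * real n ^ k < 2 ^ n" by (simp add: divide_simps mult.commute)
      moreover have "0 \<le> real n ^ k" by simp
      moreover have "(c + 1) * real n ^ k = c * real n ^ k + real n ^ k" by (simp add: algebra_simps)
      ultimately show ?case by linarith
    qed
  qed
  then show ?thesis using eventually_ge_at_top[of 1]
  proof eventually_elim
    case (elim n)
    then have "real (poly p 1 * n ^ degree p) \<le> real (2 ^ n)" by (simp add: c_def k_def)
    then show ?case using *[OF elim(2)] by linarith
  qed
qed

lemma range_gen_meets:
  assumes H: "hypothesis_H" and f: "polytime_computable f"
    and large: "\<And>x. nat_of_str x < nat_of_str (f x)"
  shows "\<exists>x. f x \<in> range gen"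
proof -
  obtain d :: real where d: "1 \<le> d" and circ: "\<And>L. L \<in> class_P \<Longrightarrow>
      \<exists>s. (\<lambda>n. real (s n)) \<in> O(\<lambda>n. real n powr d) \<and> decided_by_circuits_of_size L s"
    using H unfolding hypothesis_H_def by blast
  define D where "D = nat \<lceil>d\<rceil>"
  \<comment> \<open>The description of the circuit has length \<open>O(N ^ (2 * D))\<close>; one
    further factor \<open>N\<close> absorbs the constant.\<close>
  define K where "K = 2 * D + 1"
  have D: "d \<le> real D" "1 \<le> D" using d by (auto simp: D_def) linarith+
  obtain s where s: "(\<lambda>n. real (s n)) \<in> O(\<lambda>n. real n powr d)"
    and dec: "decided_by_circuits_of_size (lookup_lang f K) s"
    using circ[OF class_P_lookup_lang[OF f]] by blast
  obtain M and p :: "nat poly" where M: "wf_tm M" "\<And>x. tm_outputs_within M x (f x) (poly p (length x))"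
    using f unfolding polytime_computable_def by blast
  from s obtain c where c: "eventually (\<lambda>n. norm (real (s n)) \<le> c * norm (real n powr d)) sequentially"
    by (auto elim!: landau_o.bigE)
  define b where "b = nat \<lceil>c\<rceil>"
  \<comment> \<open>Bounds the length of \<open>f\<close> on the unary input: its length
    \<open>N ^ K\<close> plus the running time.\<close>
  define q where "q = [:0, 1:] ^ K + pcompose p ([:0, 1:] ^ K)"
  from c have "eventually (\<lambda>N. s N \<le> b * N ^ D \<and> 3 + 3 * b * (1 + 3 * b) \<le> N \<and>
      poly q N \<le> 2 ^ N) sequentially"
    using eventually_poly_le_power2[of q] eventually_ge_at_top[of "3 + 3 * b * (1 + 3 * b)"]
  proof eventually_elim
    case (elim N)
    then have "real N powr d \<le> real N powr real D" using D by (intro powr_mono) auto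
    then have "real N powr d \<le> real N ^ D" using elim by (simp add: powr_realpow)
    moreover have "c \<le> real b" by (simp add: b_def) linarith
    ultimately have "c * real N powr d \<le> real b * real N ^ D" by (intro mult_mono) auto
    then have "real (s N) \<le> real (b * N ^ D)" using elim by simp
    then show ?case using elim by linarith
  qed
  then obtain N where N: "s N \<le> b * N ^ D" "3 + 3 * b * (1 + 3 * b) \<le> N" "poly q N \<le> 2 ^ N"
    using eventually_happens sequentially_bot by blast
  obtain C where C: "wf_circuit N C" "length C \<le> s N"
    "\<And>z. length z = N \<Longrightarrow> circuit_eval C z \<longleftrightarrow> z \<in> lookup_lang f K"
    using dec unfolding decided_by_circuits_of_size_def by blast
  define x where "x = replicate (N ^ K) True"
  have "N ^ 1 \<le> N ^ D" using D N(2) by (intro power_increasing) auto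
  then have ND: "N \<le> N ^ D" by simp
  have len: "length C \<le> b * N ^ D" using C(2) N(1) by simp
  have "3 * length C * (N + 3 * length C) \<le> 3 * (b * N ^ D) * (N ^ D + 3 * (b * N ^ D))"
    by (intro mult_mono add_mono) (use len ND in auto)
  also have "\<dots> = 3 * b * (1 + 3 * b) * (N ^ D * N ^ D)" by (simp add: algebra_simps)
  finally have C': "3 * length C * (N + 3 * length C) \<le> 3 * b * (1 + 3 * b) * (N ^ D * N ^ D)" .
  have "N ^ D * 1 \<le> N ^ D * N ^ D" using ND N(2) by (intro mult_left_mono) auto
  then have "N + 2 \<le> 3 * (N ^ D * N ^ D)" using ND N(2) by linarith
  with C' have "N + 2 + 3 * length C * (N + 3 * length C) \<le> (3 + 3 * b * (1 + 3 * b)) * (N ^ D * N ^ D)"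
    by (simp only: distrib_right)
  \<comment> \<open>Here the threshold on \<open>N\<close> dominates the constant, at the cost of
    the additional 1 in \<open>K\<close>.\<close>
  also have "\<dots> \<le> N * (N ^ D * N ^ D)" using N(2) by (rule mult_right_mono) simp
  also have "\<dots> = N ^ K" by (simp add: K_def power_add mult_2)
  also have "\<dots> \<le> length (f x)"
    using length_mono_nat_of_str[OF large[of x]] by (simp add: x_def)
  finally have long: "N + 2 + 3 * length C * (N + 3 * length C) \<le> length (f x)" .
  have "length (f x) \<le> poly q N"
    using length_output_le[OF M(1) M(2)[of x]] by (simp add: q_def x_def poly_pcompose poly_power)
  then have "f x \<in> range gen"
    using N(2,3) by (intro output_in_range_gen[OF C(1,3)] long) (auto simp: x_def)
  then show ?thesis by blast
qed

theorem theorem5p7: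
  assumes "hypothesis_H"
  shows "\<exists>g :: str \<Rightarrow> str. polytime_computable g \<and> proof_complexity_generator g \<and>
    (\<forall>A \<in> class_NP. feasibly_infinite A \<longrightarrow> range g \<inter> A \<noteq> {})"
proof (intro exI[of _ gen] conjI ballI impI)
  fix A assume "feasibly_infinite A"
  then obtain f where "polytime_computable f" "\<And>x. nat_of_str x < nat_of_str (f x)" "\<And>x. f x \<in> A"
    unfolding feasibly_infinite_def by blast
  then show "range gen \<inter> A \<noteq> {}"
    using range_gen_meets[OF assms] by blast
qed (rule polytime_gen proof_complexity_generator_gen)+

end
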